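(* Let $\mathcal X$ be a Polish space and let $G$ be a countable group of homeomorphisms of $\mathcal X$ which acts freely on a comeager subset of $\mathcal X$, and which has a subgroup which is free on $m$ generators ($m\ge 1$). Suppose that a system of $m$ congruences is specified by pairs $(L_i,R_i)$, $1\le i\le m$, of subsets of $\{1,2,\dots,r\}$, and that this system is weak and consistent. Then there is a sequence of nonempty open sets $A_k\subseteq\mathcal X$ ($1\le k\le r$) which is a quasi-solution to the system (with witnesses in $G$). Furthermore, if the system is nonredundant, and elements $f_i$ ($1\le i\le m$) of $G$ are free generators for a free subgroup of $G$, then there is a sequence of nonempty open sets $A_k\subseteq\mathcal X$ ($1\le k\le r$) which is a quasi-solution to the system such that, for each $i\le m$, $f_i$ witnesses that $\bigcup_{k\in L_i}A_k$ is quasi-congruent to $\bigcup_{k\in R_i}A_k$.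
   Context: Fix a positive integer $r$; for $S\subseteq\{1,\dots,r\}$ write $S^c=\{1,\dots,r\}\setminus S$. A congruence is a pair $(L,R)$ of subsets of $\{1,\dots,r\}$, written formally $\bigcup_{k\in L}A_k\cong\bigcup_{k\in R}A_k$; a system of congruences is a finite list of pairs $(L_i,R_i)$, $i\le m$. Deducibility of congruences: the congruences deducible from a system are those obtained from its members (read symmetrically, so $(L,R)$ also gives $(R,L)$) by taking complements ($(L,R)$ gives $(L^c,R^c)$) and transitivity ($(L,M)$ and $(M,R)$ give $(L,R)$). The system is weak if no congruence of the form $(L,L^c)$ is deducible from it. It is nonredundant if no congruence in the system is deducible from the other congruences in the system, and no $(L_i,R_i)$ has $L_i=R_i$. Deducibility of subcongruences: let $\preceq$ be the smallest transitive relation on subsets of $\{1,\dots,r\}$ such that $L\preceq R$ whenever $L\subseteq R$, and $L_i\preceq R_i$, $R_i\preceq L_i$, $L_i^c\preceq R_i^c$, $R_i^c\preceq L_i^c$ for all $i\le m$. The system is consistent if there are no $L,R$ with $R$ a proper subset of $L$ and $L\preceq R$. Let $G$ be a group of homeomorphisms of a space $\mathcal X$. $G$ acts freely on a comeager subset if there is a comeager ($G$-invariant) set on which no nonidentity element of $G$ has a fixed point. Sets are quasi-disjoint if their intersection is meager. $A$ and $B$ are quasi-congruent, as witnessed by $\sigma\in G$, if the symmetric difference $\sigma(A)\,\triangle\, B$ is meager. A quasi-solution to a system of congruences is a sequence of sets $A_k\subseteq\mathcal X$ ($k\le r$) which are pairwise quasi-disjoint and whose union is comeager in $\mathcal X$,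 such that for each $i\le m$ there is $\sigma_i\in G$ witnessing that $\bigcup_{k\in L_i}A_k$ is quasi-congruent to $\bigcup_{k\in R_i}A_k$. *)

theory Defs
  imports "HOL-Analysis.Analysis" "HOL-Algebra.Generated_Groups"
begin

section \<open>Baire category\<close>

definition nowhere_dense :: "'a::topological_space set \<Rightarrow> bool" where
  "nowhere_dense A \<longleftrightarrow> interior (closure A) = {}"

definition meager :: "'a::topological_space set \<Rightarrow> bool" where
  "meager A \<longleftrightarrow> (\<exists>N :: nat \<Rightarrow> 'a set. (\<forall>n. nowhere_dense (N n)) \<and> A \<subseteq> (\<Union>n. N n))"

definition comeager :: "'a::topological_space set \<Rightarrow> bool" where
  "comeager A \<longleftrightarrow> meager (- A)"

definition quasi_disjoint :: "'a::topological_space set \<Rightarrow> 'a set \<Rightarrow> bool" where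
  "quasi_disjoint A B \<longleftrightarrow> meager (A \<inter> B)"

definition quasi_congruent_via :: "('a::topological_space \<Rightarrow> 'a) \<Rightarrow> 'a set \<Rightarrow> 'a set \<Rightarrow> bool" where
  "quasi_congruent_via \<sigma> A B \<longleftrightarrow> meager (sym_diff (\<sigma> ` A) B)"


section \<open>Groups of homeomorphisms and free generators\<close>

definition homeo_group :: "('a::topological_space \<Rightarrow> 'a) monoid" where
  "homeo_group =
     \<lparr>carrier = {f. \<exists>g. homeomorphism UNIV UNIV f g}, mult = (\<circ>), one = id\<rparr>"

lemma group_homeo_group: "group (homeo_group :: ('a::topological_space \<Rightarrow> 'a) monoid)"
proof (rule groupI)
  fix f g :: "'a \<Rightarrow> 'a"
  assume "f \<in> carrier homeo_group" "g \<in> carrier homeo_group"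
  then show "f \<otimes>\<^bsub>homeo_group\<^esub> g \<in> carrier homeo_group"
    by (auto simp: homeo_group_def intro: homeomorphism_compose)
next
  fix f :: "'a \<Rightarrow> 'a"
  assume "f \<in> carrier homeo_group"
  then obtain g where g: "homeomorphism UNIV UNIV f g"
    by (auto simp: homeo_group_def)
  then have "g \<in> carrier homeo_group" "g \<circ> f = id"
    by (auto simp: homeo_group_def homeomorphism_symD homeomorphism_def fun_eq_iff)
  then show "\<exists>h\<in>carrier homeo_group. h \<otimes>\<^bsub>homeo_group\<^esub> f = \<one>\<^bsub>homeo_group\<^esub>"
    by (auto simp: homeo_group_def)
qed (auto simp: homeo_group_def comp_assoc homeomorphism_def intro!: exI[of _ id])

text \<open>A letter \<open>(i, True)\<close> stands for the \<open>i\<close>-th generator and \<open>(i, False)\<close> for its inverse.\<close>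

definition word_value :: "('a, 'b) monoid_scheme \<Rightarrow> ('i \<Rightarrow> 'a) \<Rightarrow> ('i \<times> bool) list \<Rightarrow> 'a" where
  "word_value K f w =
     foldr (\<lambda>(i, b) x. (if b then f i else inv\<^bsub>K\<^esub> (f i)) \<otimes>\<^bsub>K\<^esub> x) w \<one>\<^bsub>K\<^esub>"

definition reduced_word :: "('i \<times> bool) list \<Rightarrow> bool" where
  "reduced_word w \<longleftrightarrow> successively (\<lambda>(i, a) (j, b). \<not> (i = j \<and> a \<noteq> b)) w"

text \<open>The group \<open>K\<close> is free with the family \<open>f\<close>, indexed by \<open>I\<close>, as free generators.
  The condition on reduced words forces \<open>f\<close> to be injective on \<open>I\<close>.\<close>

definition free_generators :: "('a, 'b) monoid_scheme \<Rightarrow> 'i set \<Rightarrow> ('i \<Rightarrow> 'a) \<Rightarrow> bool" where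
  "free_generators K I f \<longleftrightarrow>
     (\<forall>i\<in>I. f i \<in> carrier K) \<and>
     generate K (f ` I) = carrier K \<and>
     (\<forall>w. fst ` set w \<subseteq> I \<and> reduced_word w \<and> w \<noteq> [] \<longrightarrow> word_value K f w \<noteq> \<one>\<^bsub>K\<^esub>)"

definition acts_freely_on_comeager :: "('a::topological_space \<Rightarrow> 'a) set \<Rightarrow> bool" where
  "acts_freely_on_comeager G \<longleftrightarrow>
     (\<exists>C. comeager C \<and> (\<forall>g\<in>G. g ` C = C) \<and> (\<forall>g\<in>G. g \<noteq> id \<longrightarrow> (\<forall>x\<in>C. g x \<noteq> x)))"


section \<open>Systems of congruences\<close>

text \<open>A system of \<open>m\<close> congruences is given by families \<open>L\<close>, \<open>R\<close> of subsets of \<open>{1..r}\<close>, of which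
  only the values at indices in \<open>{1..m}\<close> matter.  Deducibility depends only on the set of
  pairs that occur.\<close>

definition congruences :: "nat set \<Rightarrow> (nat \<Rightarrow> nat set) \<Rightarrow> (nat \<Rightarrow> nat set) \<Rightarrow> (nat set \<times> nat set) set" where
  "congruences I L R = (\<lambda>i. (L i, R i)) ` I"

inductive deducible :: "nat \<Rightarrow> (nat set \<times> nat set) set \<Rightarrow> nat set \<Rightarrow> nat set \<Rightarrow> bool"
  for r :: nat and Cs :: "(nat set \<times> nat set) set" where
  member: "(L, R) \<in> Cs \<Longrightarrow> deducible r Cs L R"
| member_sym: "(L, R) \<in> Cs \<Longrightarrow> deducible r Cs R L"
| compl: "deducible r Cs L R \<Longrightarrow> deducible r Cs ({1..r} - L) ({1..r} - R)"
| trans: "deducible r Cs L M \<Longrightarrow> deducible r Cs M R \<Longrightarrow> deducible r Cs L R"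

definition weak_system :: "nat \<Rightarrow> nat \<Rightarrow> (nat \<Rightarrow> nat set) \<Rightarrow> (nat \<Rightarrow> nat set) \<Rightarrow> bool" where
  "weak_system r m L R \<longleftrightarrow>
     \<not> (\<exists>S\<subseteq>{1..r}. deducible r (congruences {1..m} L R) S ({1..r} - S))"

definition nonredundant_system :: "nat \<Rightarrow> nat \<Rightarrow> (nat \<Rightarrow> nat set) \<Rightarrow> (nat \<Rightarrow> nat set) \<Rightarrow> bool" where
  "nonredundant_system r m L R \<longleftrightarrow>
     (\<forall>i\<in>{1..m}. \<not> deducible r (congruences ({1..m} - {i}) L R) (L i) (R i)) \<and>
     (\<forall>i\<in>{1..m}. L i \<noteq> R i)"

inductive subcongruence :: "nat \<Rightarrow> (nat set \<times> nat set) set \<Rightarrow> nat set \<Rightarrow> nat set \<Rightarrow> bool"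
  for r :: nat and Cs :: "(nat set \<times> nat set) set" where
  subset: "L \<subseteq> R \<Longrightarrow> R \<subseteq> {1..r} \<Longrightarrow> subcongruence r Cs L R"
| left_right: "(L, R) \<in> Cs \<Longrightarrow> subcongruence r Cs L R"
| right_left: "(L, R) \<in> Cs \<Longrightarrow> subcongruence r Cs R L"
| compl_left_right: "(L, R) \<in> Cs \<Longrightarrow> subcongruence r Cs ({1..r} - L) ({1..r} - R)"
| compl_right_left: "(L, R) \<in> Cs \<Longrightarrow> subcongruence r Cs ({1..r} - R) ({1..r} - L)"
| trans: "subcongruence r Cs L M \<Longrightarrow> subcongruence r Cs M R \<Longrightarrow> subcongruence r Cs L R"

definition consistent_system :: "nat \<Rightarrow> nat \<Rightarrow> (nat \<Rightarrow> nat set) \<Rightarrow> (nat \<Rightarrow> nat set) \<Rightarrow> bool" where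
  "consistent_system r m L R \<longleftrightarrow>
     \<not> (\<exists>S T. S \<subseteq> {1..r} \<and> T \<subset> S \<and> subcongruence r (congruences {1..m} L R) S T)"

definition quasi_partition :: "nat \<Rightarrow> (nat \<Rightarrow> 'a::topological_space set) \<Rightarrow> bool" where
  "quasi_partition r A \<longleftrightarrow>
     (\<forall>j\<in>{1..r}. \<forall>k\<in>{1..r}. j \<noteq> k \<longrightarrow> quasi_disjoint (A j) (A k)) \<and>
     comeager (\<Union>k\<in>{1..r}. A k)"

definition quasi_solution ::
    "('a::topological_space \<Rightarrow> 'a) set \<Rightarrow> nat \<Rightarrow> nat \<Rightarrow> (nat \<Rightarrow> nat set) \<Rightarrow> (nat \<Rightarrow> nat set) \<Rightarrow>
     (nat \<Rightarrow> 'a set) \<Rightarrow> bool" where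
  "quasi_solution G r m L R A \<longleftrightarrow>
     quasi_partition r A \<and>
     (\<forall>i\<in>{1..m}. \<exists>\<sigma>\<in>G. quasi_congruent_via \<sigma> (\<Union>k\<in>L i. A k) (\<Union>k\<in>R i. A k))"

end

theory Submission
  imports Defs
begin

text \<open>Almost every orbit of the free group is a copy of its Cayley tree, and a quasi-solution amounts
  to a colouring of the points by \<open>1, \<dots>, r\<close> in which the colour of \<open>x\<close> lies in \<open>L i\<close> exactly if the
  colour of \<open>f i x\<close> lies in \<open>R i\<close>, the colour classes being open up to a meager set.  Such a
  colouring is built in stages, each recorded by the sets \<open>T x\<close> of colours still permitted at \<open>x\<close>.
  Knowing that the colour of \<open>x\<close> lies in \<open>S\<close> tells something about the colour of a neighbour in the tree: if \<open>S \<subseteq> L i\<close>, the colour of \<open>f i x\<close> lies in \<open>R i\<close>,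
  and similarly for complements and inverses.  The map \<open>push\<close> gives this information, and \<open>T\<close> is
  called admissible if it is closed under it and never empty.

  Since the orbit is a tree, an admissible \<open>T\<close> can always be refined by fixing one point \<open>y\<close> to a
  colour of \<open>T y\<close> and propagating the consequences outwards: no point is reached along two routes,
  and \<open>push_meets\<close> shows that no contradiction can arise at a single edge.  To obtain open sets one
  must treat a whole open set \<open>U\<close> of points \<open>y\<close> simultaneously, and then consequences of different
  points of the same orbit might collide.  This is where consistency, weakness and nonredundancy
  enter.  View the sets \<open>L i\<close>, \<open>R i\<close> and their complements as vertices of a graph with an edge for each
  congruence and for its complement.  Weakness and nonredundancy make this graph a forest, and
  consistency says that a chain of deductions which loses information never returns to its starting
  set.  So the sets along a chain of deductions following a reduced word are pairwise distinct
  (\<open>chain_sets_distinct\<close>), and information dies out after \<open>2 ^ r\<close> steps.  If \<open>U\<close> is so small that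
  any two of its points in one orbit are far apart, the simultaneous refinement succeeds,
  and it again has a (larger) bound on how far information spreads (\<open>update_bounded_info\<close>).
  This invariant lets the construction continue forever.  After some first stages that
  use every colour, the later stages fix a colour on some open subset of each basic open set in turn.

  For redundant systems one solves a minimal subsystem from which the others are deducible;
  the witnesses for the remaining congruences are composed from those of the subsystem.\<close>

section \<open>Meager sets\<close>

lemma nowhere_dense_iff:
  "nowhere_dense A \<longleftrightarrow> (\<forall>U. open U \<and> U \<noteq> {} \<longrightarrow> (\<exists>W. open W \<and> W \<noteq> {} \<and> W \<subseteq> U \<and> W \<inter> A = {}))"
proof
  assume nd: "nowhere_dense A"
  show "\<forall>U. open U \<and> U \<noteq> {} \<longrightarrow> (\<exists>W. open W \<and> W \<noteq> {} \<and> W \<subseteq> U \<and> W \<inter> A = {})"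
  proof (intro allI impI)
    fix U :: "'a set" assume U: "open U \<and> U \<noteq> {}"
    have "\<not> U \<subseteq> closure A"
      using nd U interior_maximal[of U "closure A"] by (auto simp: nowhere_dense_def)
    then show "\<exists>W. open W \<and> W \<noteq> {} \<and> W \<subseteq> U \<and> W \<inter> A = {}"
      using U closure_subset[of A] by (intro exI[of _ "U - closure A"]) auto
  qed
next
  assume *: "\<forall>U. open U \<and> U \<noteq> {} \<longrightarrow> (\<exists>W. open W \<and> W \<noteq> {} \<and> W \<subseteq> U \<and> W \<inter> A = {})"
  show "nowhere_dense A"
  proof (rule ccontr)
    assume "\<not> nowhere_dense A"
    then obtain W where W: "open W" "W \<noteq> {}" "W \<subseteq> interior (closure A)" "W \<inter> A = {}"
      using * by (metis nowhere_dense_def open_interior)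
    moreover have "W \<inter> closure A = {}"
      using W open_Int_closure_eq_empty by blast
    ultimately show False
      using interior_subset by fastforce
  qed
qed

lemma nowhere_dense_vimage:
  assumes "homeomorphism UNIV UNIV g h" and "nowhere_dense A"
  shows "nowhere_dense (g -` A)"
  unfolding nowhere_dense_iff
proof (intro allI impI)
  fix U :: "'a set" assume U: "open U \<and> U \<noteq> {}"
  have cont: "continuous_on UNIV g" "continuous_on UNIV h"
    and gh: "\<And>x. g (h x) = x" "\<And>x. h (g x) = x"
    using assms(1) by (auto simp: homeomorphism_def)
  have "open (h -` U)" "h -` U \<noteq> {}"
    using U cont(2) gh(2) by (simp_all add: open_vimage surjI[of h g] surj_def[symmetric] surj_vimage_empty)
  then obtain W where W: "open W" "W \<noteq> {}" "W \<subseteq> h -` U" "W \<inter> A = {}"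
    using assms(2) unfolding nowhere_dense_iff by blast
  show "\<exists>W. open W \<and> W \<noteq> {} \<and> W \<subseteq> U \<and> W \<inter> g -` A = {}"
  proof (intro exI[of _ "g -` W"] conjI)
    show "open (g -` W)" using W cont by (simp add: open_vimage)
    show "g -` W \<noteq> {}" using W(2) gh(1) by (simp add: surjI[of g h] surj_vimage_empty)
    show "g -` W \<subseteq> U" using subsetD[OF W(3), of "g _"] gh(2) by auto
    show "g -` W \<inter> g -` A = {}" using W(4) by auto
  qed
qed

lemma meager_subset: "meager B \<Longrightarrow> A \<subseteq> B \<Longrightarrow> meager A"
  unfolding meager_def by (meson order_trans)

lemma nowhere_dense_empty: "nowhere_dense {}"
  by (simp add: nowhere_dense_def)

lemma nowhere_dense_imp_meager: "nowhere_dense A \<Longrightarrow> meager A"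
  unfolding meager_def by (rule exI[of _ "\<lambda>_. A"]) auto

lemma meager_UN:
  assumes "countable I" and "\<And>i. i \<in> I \<Longrightarrow> meager (A i)"
  shows "meager (\<Union>i\<in>I. A i)"
proof (cases "I = {}")
  case True
  then show ?thesis using nowhere_dense_imp_meager[OF nowhere_dense_empty] by simp
next
  case False
  obtain N where N: "\<And>i n. i \<in> I \<Longrightarrow> nowhere_dense (N i n)"
    "\<And>i. i \<in> I \<Longrightarrow> A i \<subseteq> (\<Union>n::nat. N i n)"
    using assms(2) unfolding meager_def by metis
  define N' where "N' p = (case prod_decode p of (a, b) \<Rightarrow> N (from_nat_into I a) b)" for p
  show ?thesis
    unfolding meager_def
  proof (intro exI[of _ N'] conjI allI subsetI)
    fix p show "nowhere_dense (N' p)"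
      unfolding N'_def using N(1) from_nat_into[OF False] by (auto split: prod.splits)
  next
    fix x assume "x \<in> (\<Union>i\<in>I. A i)"
    then obtain i n where "i \<in> I" "x \<in> N i n" using N(2) by fastforce
    then have "x \<in> N' (prod_encode (to_nat_on I i, n))"
      unfolding N'_def by (simp add: assms(1))
    then show "x \<in> (\<Union>p. N' p)" by blast
  qed
qed

lemma meager_Un: "meager A \<Longrightarrow> meager B \<Longrightarrow> meager (A \<union> B)"
  using meager_UN[of UNIV "\<lambda>b. if b then A else B"] by (simp add: UNIV_bool Un_commute)

lemma meager_vimage:
  assumes "homeomorphism UNIV UNIV g h" and "meager A"
  shows "meager (g -` A)"
proof -
  obtain N where N: "\<And>n::nat. nowhere_dense (N n)" "A \<subseteq> (\<Union>n. N n)"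
    using assms(2) unfolding meager_def by blast
  have "\<And>n. nowhere_dense (g -` N n)"
    using nowhere_dense_vimage[OF assms(1) N(1)] .
  moreover have "g -` A \<subseteq> (\<Union>n. g -` N n)"
    using N(2) by blast
  ultimately show ?thesis
    unfolding meager_def by (intro exI[of _ "\<lambda>n. g -` N n"] conjI allI)
qed

lemma comeager_imp_meets_open:
  fixes C :: "'a::polish_space set"
  assumes "comeager C" "open V" "V \<noteq> {}"
  shows "V \<inter> C \<noteq> {}"
proof -
  obtain N where N: "\<And>n::nat. nowhere_dense (N n)" "- C \<subseteq> (\<Union>n. N n)"
    using assms(1) unfolding comeager_def meager_def by blast
  have "euclidean closure_of \<Inter> (range (\<lambda>n. - closure (N n))) = topspace euclidean"
  proof (rule Baire_category)
    fix T assume "T \<in> range (\<lambda>n. - closure (N n))"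
    then obtain n where T: "T = - closure (N n)" by blast
    show "openin euclidean T \<and> euclidean closure_of T = topspace euclidean"
      using N(1)[of n] by (simp add: T closure_complement nowhere_dense_def open_Compl)
  qed (auto simp: completely_metrizable_space_euclidean)
  then have "closure (\<Inter> (range (\<lambda>n. - closure (N n)))) = UNIV"
    by simp
  then have "V \<inter> \<Inter> (range (\<lambda>n. - closure (N n))) \<noteq> {}"
    using assms(2,3) open_Int_closure_eq_empty[of V] by blast
  then obtain x where x: "x \<in> V" "\<And>n. x \<notin> closure (N n)"
    by auto
  then have "x \<in> C"
    using N(2) closure_subset by blast
  then show ?thesis
    using x by auto
qed

lemma nowhere_dense_frontier: "open B \<Longrightarrow> nowhere_dense (frontier B)"
  unfolding nowhere_dense_iff
proof (intro allI impI)
  fix U :: "'a set" assume "open B" "open U \<and> U \<noteq> {}"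
  then show "\<exists>W. open W \<and> W \<noteq> {} \<and> W \<subseteq> U \<and> W \<inter> frontier B = {}"
  proof (cases "U \<inter> B = {}")
    case True
    then have "U \<inter> closure B = {}"
      using \<open>open U \<and> U \<noteq> {}\<close> open_Int_closure_eq_empty by blast
    then show ?thesis
      using \<open>open U \<and> U \<noteq> {}\<close> by (intro exI[of _ U]) (auto simp: frontier_def)
  next
    case False
    then show ?thesis
      using \<open>open B\<close> \<open>open U \<and> U \<noteq> {}\<close>
      by (intro exI[of _ "U \<inter> B"]) (auto simp: frontier_def interior_open)
  qed
qed

lemma comeager_open_dense:
  assumes "open D" "\<And>V. open V \<Longrightarrow> V \<noteq> {} \<Longrightarrow> V \<inter> D \<noteq> {}"
  shows "comeager D"
  unfolding comeager_def
proof (intro nowhere_dense_imp_meager, unfold nowhere_dense_iff, intro allI impI)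
  fix U :: "'a set" assume "open U \<and> U \<noteq> {}"
  then show "\<exists>W. open W \<and> W \<noteq> {} \<and> W \<subseteq> U \<and> W \<inter> - D = {}"
    using assms by (intro exI[of _ "U \<inter> D"]) auto
qed


section \<open>Words acting freely\<close>

definition inv_letter :: "'i \<times> bool \<Rightarrow> 'i \<times> bool" where
  "inv_letter l = (fst l, \<not> snd l)"

definition inv_word :: "('i \<times> bool) list \<Rightarrow> ('i \<times> bool) list" where
  "inv_word w = rev (map inv_letter w)"

lemma fst_inv_letter [simp]: "fst (inv_letter l) = fst l"
  and inv_letter_inv_letter [simp]: "inv_letter (inv_letter l) = l"
  by (simp_all add: inv_letter_def)

lemma length_inv_word [simp]: "length (inv_word w) = length w"
  by (simp add: inv_word_def)

lemma inv_word_inv_word [simp]: "inv_word (inv_word w) = w"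
  by (simp add: inv_word_def rev_map comp_def)

lemma reduced_word_Nil [simp]: "reduced_word []"
  by (simp add: reduced_word_def)

lemma reduced_word_Cons:
  "reduced_word (l # w) \<longleftrightarrow> w = [] \<or> (hd w \<noteq> inv_letter l \<and> reduced_word w)"
  by (cases l; cases "hd w")
    (auto simp: reduced_word_def successively_Cons inv_letter_def)

lemma reduced_word_appendD:
  assumes "reduced_word (v @ w)"
  shows "reduced_word v" "reduced_word w"
  using assms by (auto simp: reduced_word_def successively_append_iff)

text \<open>Words act through \<open>foldr\<close>, so the last letter acts first and a word is extended at its head.
  Two words with different heads therefore do not cancel in the quotient of their actions.\<close>

lemma reduced_inv_word_append:
  assumes "reduced_word (l # v)" "reduced_word (m # w)" "l \<noteq> m"
  shows "reduced_word (inv_word (l # v) @ m # w)"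
proof -
  have "reduced_word (inv_word (l # v))"
    using assms(1) unfolding reduced_word_def inv_word_def
    by (simp only: successively_rev successively_map)
      (auto simp: inv_letter_def case_prod_beta elim!: successively_mono)
  then show ?thesis
    using assms(2,3) unfolding reduced_word_def inv_word_def
    by (auto simp: successively_append_iff inv_letter_def prod_eq_iff)
qed

text \<open>The orbits in \<open>C\<close> are Cayley trees of the free group on \<open>I\<close>.  The condition \<open>small_clopen\<close> makes \<open>C\<close>
  zero-dimensional, so that neighbourhoods can be chosen with indicator functions that are
  locally constant on \<open>C\<close>.\<close>

locale free_word_action =
  fixes I :: "'i set" and act :: "'i \<times> bool \<Rightarrow> 'a::polish_space \<Rightarrow> 'a" and C :: "'a set"
  assumes finite_I: "finite I" and I_nonempty: "I \<noteq> {}"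
    and continuous_act: "fst l \<in> I \<Longrightarrow> continuous_on UNIV (act l)"
    and act_closed: "fst l \<in> I \<Longrightarrow> x \<in> C \<Longrightarrow> act l x \<in> C"
    and act_inv: "fst l \<in> I \<Longrightarrow> act (inv_letter l) (act l x) = x"
    and comeager_C: "comeager C"
    and free: "fst ` set w \<subseteq> I \<Longrightarrow> reduced_word w \<Longrightarrow> w \<noteq> [] \<Longrightarrow> x \<in> C \<Longrightarrow> foldr act w x \<noteq> x"
    and small_clopen: "open V \<Longrightarrow> x \<in> V \<Longrightarrow> x \<in> C \<Longrightarrow>
      \<exists>U. open U \<and> x \<in> U \<and> U \<subseteq> V \<and>
        (\<forall>z\<in>C. \<forall>\<^sub>F y in inf (nhds z) (principal C). y \<in> U \<longleftrightarrow> z \<in> U)"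
begin

abbreviation run :: "('i \<times> bool) list \<Rightarrow> 'a \<Rightarrow> 'a" where
  "run \<equiv> foldr act"

definition word :: "('i \<times> bool) list \<Rightarrow> bool" where
  "word w \<longleftrightarrow> fst ` set w \<subseteq> I"

definition good :: "('i \<times> bool) list \<Rightarrow> bool" where
  "good w \<longleftrightarrow> word w \<and> reduced_word w"

lemma word_simps [simp]:
  "word []" "word (l # w) \<longleftrightarrow> fst l \<in> I \<and> word w" "word (v @ w) \<longleftrightarrow> word v \<and> word w"
  "word (inv_word w) \<longleftrightarrow> word w"
  by (auto simp: word_def inv_word_def image_image)

lemma good_Nil [simp]: "good []"
  by (simp add: good_def)

lemma good_imp_word [simp]: "good w \<Longrightarrow> word w"
  by (simp add: good_def)

lemma good_Cons:
  "good (l # w) \<longleftrightarrow> fst l \<in> I \<and> good w \<and> (w = [] \<or> hd w \<noteq> inv_letter l)"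
  by (auto simp: good_def reduced_word_Cons)

lemma good_appendD:
  assumes "good (v @ w)"
  shows "good v" "good w"
  using assms reduced_word_appendD by (auto simp: good_def)

lemma run_closed [simp]: "word w \<Longrightarrow> x \<in> C \<Longrightarrow> run w x \<in> C"
  by (induction w) (auto simp: act_closed)

lemma act_inv': "fst l \<in> I \<Longrightarrow> act l (act (inv_letter l) x) = x"
  using act_inv[of "inv_letter l" x] by simp

lemma run_inv_word [simp]: "word w \<Longrightarrow> run (inv_word w) (run w x) = x"
  by (induction w) (auto simp: inv_word_def act_inv)

lemma continuous_run: "word w \<Longrightarrow> continuous_on UNIV (run w)"
proof (induction w)
  case (Cons l w)
  then have "continuous_on UNIV (act l \<circ> run w)"
    by (intro continuous_on_compose2[of UNIV "act l" UNIV "run w", folded comp_def])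
      (auto simp: continuous_act)
  then show ?case by (simp add: comp_def)
qed (simp add: id_def[symmetric])

lemma finite_short_words: "finite {w. word w \<and> length w \<le> d}"
proof -
  have "{w. word w \<and> length w \<le> d} = {w. set w \<subseteq> I \<times> UNIV \<and> length w \<le> d}"
    by (auto simp: word_def)
  then show ?thesis
    by (simp add: finite_lists_length_le finite_I)
qed

lemma run_good_unique:
  assumes "good v" "good w" "x \<in> C" "run v x = run w x"
  shows "v = w"
  using assms
proof (induction v arbitrary: w)
  case Nil
  then show ?case using free[of w x] by (auto simp: good_def word_def)
next
  case (Cons l v)
  show ?case
  proof (cases w)
    case Nil
    then show ?thesis
      using free[of "l # v" x] Cons.prems unfolding good_def word_def by simp
  next
    case (Cons m u)
    note w = this
    show ?thesis
    proof (cases "l = m")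
      case True
      then have "run v x = run u x"
        using Cons.prems w act_inv[of l] by (metis foldr.simps(2) comp_apply good_Cons)
      then show ?thesis
        using Cons.IH[of u] Cons.prems w True by (auto simp: good_Cons)
    next
      case False
      let ?z = "inv_word (l # v) @ m # u"
      have "reduced_word ?z"
        using reduced_inv_word_append[of l v m u] False Cons.prems w by (simp add: good_def)
      moreover have "word ?z"
        using Cons.prems w by (auto simp: good_def)
      moreover have "run ?z x = x"
        using Cons.prems w run_inv_word[of "l # v" x]
        by (simp add: foldr_append good_def del: run_inv_word)
      ultimately show ?thesis
        using free[of ?z x] Cons.prems unfolding word_def by auto
    qed
  qed
qed

lemma reduce_word:
  assumes "word w"
  obtains v where "good v" "length v \<le> length w" "\<And>x. run v x = run w x"
proof -
  have "\<exists>v. good v \<and> length v \<le> length w \<and> (\<forall>x. run v x = run w x)"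
    using assms
  proof (induction w)
    case (Cons l w)
    then obtain v where v: "good v" "length v \<le> length w" "\<forall>x. run v x = run w x"
      by auto
    show ?case
    proof (cases "good (l # v)")
      case True
      then show ?thesis using v by (intro exI[of _ "l # v"]) auto
    next
      case False
      then obtain u where u: "v = inv_letter l # u"
        using v Cons.prems by (cases v) (auto simp: good_Cons)
      have "run u x = run (l # w) x" for x
        using v(3)[rule_format, of x] u act_inv'[of l "run u x"] Cons.prems by auto
      then show ?thesis
        using v u by (intro exI[of _ u]) (auto simp: good_Cons)
    qed
  qed auto
  then show ?thesis using that by blast
qed

text \<open>Reduced words are the geodesics of the tree.\<close>

lemma good_length_le:
  assumes "good v" "word w" "x \<in> C" "run v x = run w x"
  shows "length v \<le> length w"
  using assms by (metis reduce_word run_good_unique)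

end


section \<open>The graph of congruences\<close>

lemma deducible_sym: "deducible r Cs S T \<Longrightarrow> deducible r Cs T S"
  by (induction rule: deducible.induct) (auto intro: deducible.intros simp del: One_nat_def)

lemma deducible_mono: "deducible r Cs S T \<Longrightarrow> Cs \<subseteq> Cs' \<Longrightarrow> deducible r Cs' S T"
  by (induction rule: deducible.induct) (auto intro: deducible.intros simp del: One_nat_def)

lemma subcongruence_mono:
  "subcongruence r Cs S T \<Longrightarrow> Cs \<subseteq> Cs' \<Longrightarrow> subcongruence r Cs' S T"
  by (induction rule: subcongruence.induct) (auto intro: subcongruence.intros simp del: One_nat_def)

lemma deducible_cut:
  assumes "deducible r Cs S T" and "\<And>A B. (A, B) \<in> Cs \<Longrightarrow> A = B \<or> deducible r Cs' A B"
  shows "S = T \<or> deducible r Cs' S T"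
  using assms(1)
proof (induction rule: deducible.induct)
  case (member S T)
  then show ?case using assms(2) by blast
next
  case (member_sym S T)
  then show ?case using assms(2) deducible_sym by blast
next
  case (compl S T)
  then show ?case using deducible.compl by metis
next
  case (trans S M T)
  then show ?case using deducible.trans by metis
qed

text \<open>A congruence \<open>(S, S)\<close> is always solved by the identity, but it need not be deducible; it is
  therefore treated separately throughout.  The required \<open>J\<close> is one of least size.\<close>

lemma nonredundant_core:
  fixes L R :: "nat \<Rightarrow> nat set"
  assumes "finite I"
  obtains J where "J \<subseteq> I"
    "\<And>i. i \<in> I \<Longrightarrow> L i = R i \<or> deducible r (congruences J L R) (L i) (R i)"
    "\<And>i. i \<in> J \<Longrightarrow> L i \<noteq> R i"
    "\<And>i. i \<in> J \<Longrightarrow> \<not> deducible r (congruences (J - {i}) L R) (L i) (R i)"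
proof -
  let ?P = "\<lambda>J. J \<subseteq> I \<and> (\<forall>i\<in>I. L i = R i \<or> deducible r (congruences J L R) (L i) (R i))"
  have "?P I"
    by (auto simp: congruences_def intro: deducible.member)
  then obtain J where J: "?P J" and least: "\<And>J'. ?P J' \<Longrightarrow> card J \<le> card J'"
    using ex_has_least_nat[of ?P I card] by blast
  have "L i \<noteq> R i \<and> \<not> deducible r (congruences (J - {i}) L R) (L i) (R i)" if i: "i \<in> J" for i
  proof (rule ccontr)
    let ?Cs = "congruences (J - {i}) L R"
    assume "\<not> ?thesis"
    then have "A = B \<or> deducible r ?Cs A B" if "(A, B) \<in> congruences J L R" for A B
      using that by (auto simp: congruences_def intro: deducible.member)
    then have "?P (J - {i})"
      using J deducible_cut[of r "congruences J L R" _ _ ?Cs] by (meson Diff_subset order_trans)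
    then have "card J \<le> card (J - {i})"
      by (rule least)
    moreover have "finite J"
      using J assms finite_subset by blast
    ultimately show False
      using i card_Diff1_less[of J i] by simp
  qed
  then show ?thesis
    using that[of J] J by blast
qed

text \<open>The congruences range over an index set \<open>J\<close> that may be smaller than the set of generators, since
  a redundant system is replaced by a subsystem.\<close>

locale congruence_forest =
  fixes r :: nat and J :: "nat set" and L R :: "nat \<Rightarrow> nat set"
  assumes r_pos: "r \<ge> 1"
    and sides: "i \<in> J \<Longrightarrow> L i \<subseteq> {1..r} \<and> R i \<subseteq> {1..r}"
    and weak: "S \<subseteq> {1..r} \<Longrightarrow> \<not> deducible r (congruences J L R) S ({1..r} - S)"
    and consistent: "S \<subseteq> {1..r} \<Longrightarrow> T \<subset> S \<Longrightarrow> \<not> subcongruence r (congruences J L R) S T"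
    and nonredundant: "i \<in> J \<Longrightarrow> \<not> deducible r (congruences (J - {i}) L R) (L i) (R i)"
    and nontrivial: "i \<in> J \<Longrightarrow> L i \<noteq> R i"
begin

text \<open>The pair \<open>(l, s)\<close> is a directed edge of the graph of congruences from \<open>side l s\<close> to
  \<open>side (inv_letter l) s\<close>; the flag \<open>s\<close> tells whether it comes from the congruence of \<open>l\<close> or from
  the complemented one.\<close>

definition side :: "nat \<times> bool \<Rightarrow> bool \<Rightarrow> nat set" where
  "side l s = (let A = (if snd l then L (fst l) else R (fst l)) in if s then A else {1..r} - A)"

text \<open>What is known about the colour of the \<open>l\<close>-neighbour of a point whose colour lies in \<open>S\<close>.\<close>

definition push :: "nat \<times> bool \<Rightarrow> nat set \<Rightarrow> nat set" where
  "push l S =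
     (if fst l \<in> J \<and> S \<subseteq> side l True then side (inv_letter l) True
      else if fst l \<in> J \<and> S \<subseteq> side l False then side (inv_letter l) False
      else {1..r})"

lemma side_subset: "fst l \<in> J \<Longrightarrow> side l s \<subseteq> {1..r}"
  using sides[of "fst l"] by (auto simp: side_def Let_def)

lemma side_compl: "fst l \<in> J \<Longrightarrow> {1..r} - side l s = side l (\<not> s)"
  using sides[of "fst l"] by (auto simp: side_def Let_def)

lemma push_subset: "push l S \<subseteq> {1..r}"
  using side_subset[of "inv_letter l"] by (auto simp: push_def)

lemma push_side: "push l S \<noteq> {1..r} \<Longrightarrow>
    \<exists>s. fst l \<in> J \<and> S \<subseteq> side l s \<and> push l S = side (inv_letter l) s"
  unfolding push_def by metis

lemma push_eq_side:
  assumes "fst l \<in> J" "S \<subseteq> side l s" "S \<noteq> {}"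
  shows "push l S = side (inv_letter l) s"
proof (cases s)
  case False
  have "side l True \<inter> side l False = {}"
    by (auto simp: side_def Let_def)
  then show ?thesis
    using assms False by (auto simp: push_def)
qed (use assms in \<open>auto simp: push_def\<close>)

text \<open>This is the local reason why propagation in a tree never fails.  If \<open>Y\<close>, the permitted set at the
  neighbour, missed \<open>push l S\<close>, it would lie in the complementary side, and pushing it back would
  have excluded \<open>S\<close> from \<open>X\<close> already.\<close>

lemma push_meets:
  assumes "S \<noteq> {}" "S \<subseteq> X" "X \<subseteq> push (inv_letter l) Y" "Y \<noteq> {}" "Y \<subseteq> {1..r}"
  shows "Y \<inter> push l S \<noteq> {}"
proof (rule ccontr)
  assume empty: "\<not> Y \<inter> push l S \<noteq> {}"
  then have "push l S \<noteq> {1..r}"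
    using assms by auto
  then obtain s where s: "fst l \<in> J" "S \<subseteq> side l s" "push l S = side (inv_letter l) s"
    using push_side by metis
  then have "Y \<subseteq> side (inv_letter l) (\<not> s)"
    using empty assms(5) side_compl[of "inv_letter l" s] by auto
  then have "push (inv_letter l) Y = side l (\<not> s)"
    using push_eq_side[of "inv_letter l" Y "\<not> s"] s assms by simp
  then show False
    using s assms side_compl[of l s] by blast
qed

text \<open>Information that goes along an edge and straight back brings nothing new.\<close>

lemma push_backtrack:
  assumes "S \<noteq> {}" "S \<subseteq> X" "X \<subseteq> {1..r}" "X \<subseteq> push (inv_letter l) Y"
    "Y \<noteq> {}" "Y \<subseteq> {1..r}"
  shows "S \<subseteq> push (inv_letter l) (Y \<inter> push l S)"
proof (cases "push (inv_letter l) (Y \<inter> push l S) = {1..r}")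
  case True
  then show ?thesis using assms by auto
next
  case False
  then obtain s where s: "fst l \<in> J" "Y \<inter> push l S \<subseteq> side (inv_letter l) s"
    "push (inv_letter l) (Y \<inter> push l S) = side l s"
    using push_side[OF False] by auto
  have meets: "Y \<inter> push l S \<noteq> {}"
    using push_meets assms by blast
  show ?thesis
  proof (cases "push l S = {1..r}")
    case True
    then have "Y \<subseteq> side (inv_letter l) s"
      using s assms by auto
    then have "push (inv_letter l) Y = side l s"
      using push_eq_side[of "inv_letter l" Y s] s assms by simp
    then show ?thesis using s assms by auto
  next
    case False
    then obtain s' where s': "S \<subseteq> side l s'" "push l S = side (inv_letter l) s'"
      using push_side by metis
    have "s' = s"
      using s(2) s'(2) meets side_compl[of "inv_letter l" s] s(1) by (cases s; cases s') auto
    then show ?thesis using s s' by auto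
  qed
qed

lemma subcongruence_side:
  assumes "fst l \<in> J"
  shows "subcongruence r (congruences J L R) (side l s) (side (inv_letter l) s)"
proof -
  have "(L (fst l), R (fst l)) \<in> congruences J L R"
    using assms by (auto simp: congruences_def)
  then show ?thesis
    by (cases s; cases "snd l")
      (auto simp: side_def inv_letter_def simp del: One_nat_def intro: subcongruence.intros)
qed

lemma deducible_side:
  assumes "fst l \<in> K"
  shows "deducible r (congruences K L R) (side l s) (side (inv_letter l) s)"
proof -
  have "(L (fst l), R (fst l)) \<in> congruences K L R"
    using assms by (auto simp: congruences_def)
  then show ?thesis
    by (cases s; cases "snd l")
      (auto simp: side_def inv_letter_def simp del: One_nat_def
        intro: deducible.member deducible.member_sym deducible.compl)
qed

lemma not_deducible_side:
  assumes "fst l \<in> J"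
  shows "\<not> deducible r (congruences (J - {fst l}) L R) (side l s) (side (inv_letter l) s)"
proof
  let ?ded = "deducible r (congruences (J - {fst l}) L R)"
  assume "?ded (side l s) (side (inv_letter l) s)"
  then have "?ded (side l True) (side (inv_letter l) True)"
    using deducible.compl[of r _ "side l s" "side (inv_letter l) s"]
      side_compl[of l] side_compl[of "inv_letter l"] assms by (cases s) auto
  then have "?ded (L (fst l)) (R (fst l))"
    using deducible_sym by (cases "snd l") (auto simp: side_def inv_letter_def)
  then show False
    using nonredundant[OF assms] by simp
qed

lemma side_neq: "fst l \<in> J \<Longrightarrow> side l s \<noteq> side (inv_letter l) s"
  using nontrivial[of "fst l"] sides[of "fst l"]
  by (cases s; cases "snd l") (auto simp: side_def inv_letter_def)

text \<open>If \<open>D i = D j\<close>, consistency forces every inclusion \<open>D t \<subseteq> side (l t) (s t)\<close> in between to be an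
  equality, so that the chain is a closed walk in the graph of congruences; by induction on its
  length it repeats no vertex.  The congruence used by its first edge cannot be used again:
  traversing the same edge would repeat a vertex or cancel a letter, and traversing
  the complemented edge would put a set and its complement on the same walk, against weakness.
  The rest of the walk then deduces that congruence from the others, against nonredundancy.\<close>

lemma chain_sets_distinct:
  fixes D :: "nat \<Rightarrow> nat set" and l :: "nat \<Rightarrow> nat \<times> bool"
  assumes step: "\<And>t. t < n \<Longrightarrow> D (Suc t) = push (l t) (D t) \<and> D (Suc t) \<noteq> {1..r}"
    and reduced: "\<And>t. Suc t < n \<Longrightarrow> l (Suc t) \<noteq> inv_letter (l t)"
    and D: "\<And>t. t \<le> n \<Longrightarrow> D t \<subseteq> {1..r}"
    and "i < j" "j \<le> n"
  shows "D i \<noteq> D j"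
  using \<open>i < j\<close> \<open>j \<le> n\<close>
proof (induction "j - i" arbitrary: i j rule: less_induct)
  case less
  let ?Cs = "congruences J L R"
  note ij = less.prems
  have closer: "D a \<noteq> D b" if "i \<le> a" "a < b" "b \<le> j" "b - a < j - i" for a b
    using less.hyps[of b a] that ij by auto
  have "\<exists>s. fst (l t) \<in> J \<and> D t \<subseteq> side (l t) s \<and> D (Suc t) = side (inv_letter (l t)) s"
    if "t < n" for t
    using push_side[of "l t" "D t"] step[OF that] by auto
  then obtain s where s: "\<And>t. t < n \<Longrightarrow> fst (l t) \<in> J"
    "\<And>t. t < n \<Longrightarrow> D t \<subseteq> side (l t) (s t)"
    "\<And>t. t < n \<Longrightarrow> D (Suc t) = side (inv_letter (l t)) (s t)"
    by metis
  have sub: "subcongruence r ?Cs (D a) (D b)" if "a \<le> b" "b \<le> n" for a b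
    using that
  proof (induction rule: dec_induct)
    case base
    then show ?case using D by (auto intro: subcongruence.subset simp del: One_nat_def)
  next
    case (step t)
    then have t: "t < n" by simp
    have "subcongruence r ?Cs (D t) (side (l t) (s t))"
      using s[OF t] side_subset by (metis subcongruence.subset)
    then show ?case
      using step t s(3)[OF t] subcongruence_side[OF s(1)[OF t], of "s t"]
      by (auto intro: subcongruence.trans)
  qed
  show ?case
  proof
    assume eq: "D i = D j"
    \<comment> \<open>Strictness anywhere would give \<open>side (l t) (s t) \<preceq> D j = D i \<preceq> D t \<subset> side (l t) (s t)\<close>.\<close>
    have exact: "D t = side (l t) (s t)" if "i \<le> t" "t < j" for t
    proof (rule ccontr)
      assume neq: "D t \<noteq> side (l t) (s t)"
      have t: "t < n" using that ij by simp
      have "D t \<subset> side (l t) (s t)"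
        using s(2)[OF t] neq by blast
      moreover have "subcongruence r ?Cs (side (l t) (s t)) (D (Suc t))"
        using subcongruence_side[OF s(1)[OF t], of "s t"] s(3)[OF t] by simp
      moreover have "subcongruence r ?Cs (D (Suc t)) (D j)" "subcongruence r ?Cs (D i) (D t)"
        using sub that ij t by auto
      ultimately show False
        using consistent[OF side_subset[OF s(1)[OF t]]] eq by (metis subcongruence.trans)
    qed
    have ded: "deducible r (congruences K L R) (D a) (D b)"
      if "i \<le> a" "a < b" "b \<le> j" "\<And>t. a \<le> t \<Longrightarrow> t < b \<Longrightarrow> fst (l t) \<in> K" for a b K
    proof -
      have "Suc a \<le> b" using that by simp
      then show ?thesis
        using that(3,4)
      proof (induction rule: dec_induct)
        case base
        then show ?case
          using deducible_side[of "l a" K "s a"] exact[of a] s(3)[of a] that(1) ij by simp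
      next
        case (step t)
        then have "deducible r (congruences K L R) (D t) (D (Suc t))"
          using deducible_side[of "l t" K "s t"] exact[of t] s(3)[of t] that(1) ij by simp
        then show ?case
          using step by (auto intro: deducible.trans)
      qed
    qed
    have i: "i < n" "fst (l i) \<in> J" using ij s by auto
    have Di: "D i = side (l i) (s i)" and DSi: "D (Suc i) = side (inv_letter (l i)) (s i)"
      using exact[of i] s(3)[of i] ij by auto
    \<comment> \<open>The congruence of the first edge does not recur on the walk.\<close>
    have new: "fst (l t) \<noteq> fst (l i)" if "i < t" "t < j" for t
    proof
      assume same: "fst (l t) = fst (l i)"
      have Dt: "D t = side (l t) (s t)" and t: "t < n" using exact that ij by auto
      have r: "D t \<noteq> {1..r} - D a" if "i \<le> a" "a \<le> t" for a
      proof
        assume c: "D t = {1..r} - D a"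
        have "D a \<subseteq> {1..r}" using D that t by simp
        moreover have "D t \<noteq> D a"
          using c \<open>D a \<subseteq> {1..r}\<close> r_pos by (cases "1 \<in> D a") auto
        then have "a < t" using that by (cases "a = t") auto
        ultimately show False
          using ded[of a t J] s(1) that \<open>t < j\<close> ij weak[of "D a"] c by auto
      qed
      have "l t = l i \<or> l t = inv_letter (l i)"
        using same by (cases "l t"; cases "l i") (auto simp: inv_letter_def)
      then show False
      proof
        assume "l t = l i"
        have "D i \<noteq> D t"
          using that ij by (intro closer) auto
        then show False
          using \<open>l t = l i\<close> r[of i] that Dt Di side_compl[OF i(2), of "s i"]
          by (cases "s t = s i") auto
      next
        assume inv: "l t = inv_letter (l i)"
        have "Suc i \<noteq> t" using reduced[of i] inv t by auto
        then have "D (Suc i) \<noteq> D t"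
          using that ij by (intro closer) auto
        then show False
          using r[of "Suc i"] that Dt DSi inv
            side_compl[of "inv_letter (l i)" "s i"] i(2)
          by (cases "s t = s i") auto
      qed
    qed
    show False
    proof (cases "Suc i = j")
      case True
      then show False
        using eq Di DSi side_neq[OF i(2)] by metis
    next
      case False
      have "deducible r (congruences (J - {fst (l i)}) L R) (D (Suc i)) (D j)"
        using ded[of "Suc i" j "J - {fst (l i)}"] False ij s(1) new by auto
      then show False
        using not_deducible_side[OF i(2)] deducible_sym eq Di DSi by metis
    qed
  qed
qed

end


section \<open>Propagation of information along orbits\<close>

locale congruence_dynamics =
  congruence_forest r J L R + free_word_action I act C
  for r :: nat and J :: "nat set" and L R :: "nat \<Rightarrow> nat set"
    and I :: "nat set" and act :: "nat \<times> bool \<Rightarrow> 'a::polish_space \<Rightarrow> 'a" and C :: "'a set"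
begin

abbreviation nhds_C :: "'a \<Rightarrow> 'a filter" where
  "nhds_C x \<equiv> inf (nhds x) (principal C)"

definition locally_constant :: "('a \<Rightarrow> nat set) \<Rightarrow> bool" where
  "locally_constant T \<longleftrightarrow> (\<forall>x\<in>C. \<forall>\<^sub>F y in nhds_C x. T y = T x)"

text \<open>\<open>T x\<close> is the set of colours still permitted at \<open>x\<close>.  Admissibility is arc consistency of these
  sets along the edges of the orbits.\<close>

definition admissible :: "('a \<Rightarrow> nat set) \<Rightarrow> bool" where
  "admissible T \<longleftrightarrow> (\<forall>x\<in>C. T x \<noteq> {} \<and> T x \<subseteq> {1..r} \<and>
     (\<forall>l. fst l \<in> I \<longrightarrow> T (act l x) \<subseteq> push l (T x)))"

text \<open>The permitted set that results at \<open>run w x\<close> if the permitted set at \<open>x\<close> is lowered to \<open>S\<close> and this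
  is propagated along the path \<open>w\<close>.\<close>

fun info :: "('a \<Rightarrow> nat set) \<Rightarrow> nat set \<Rightarrow> 'a \<Rightarrow> (nat \<times> bool) list \<Rightarrow> nat set" where
  "info T S x [] = S"
| "info T S x (l # w) = T (run (l # w) x) \<inter> push l (info T S x w)"

text \<open>Lowering the set at one point affects only points at distance at most \<open>M\<close> in the tree.  The set \<open>S\<close>
  is arbitrary, not just a singleton, so that the condition passes to final segments of paths.\<close>

definition bounded_info :: "nat \<Rightarrow> ('a \<Rightarrow> nat set) \<Rightarrow> bool" where
  "bounded_info M T \<longleftrightarrow> (\<forall>x\<in>C. \<forall>S w. S \<noteq> {} \<longrightarrow> S \<subseteq> T x \<longrightarrow> good w \<longrightarrow> M < length w \<longrightarrow>
     info T S x w = T (run w x))"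

definition separated :: "nat \<Rightarrow> 'a set \<Rightarrow> bool" where
  "separated d U \<longleftrightarrow>
     (\<forall>u\<in>U \<inter> C. \<forall>w. word w \<longrightarrow> length w \<le> d \<longrightarrow> run w u \<in> U \<longrightarrow> run w u = u)"

lemma admissibleD:
  assumes "admissible T" "x \<in> C"
  shows "T x \<noteq> {}" "T x \<subseteq> {1..r}" "fst l \<in> I \<Longrightarrow> T (act l x) \<subseteq> push l (T x)"
  using assms unfolding admissible_def by blast+

lemma admissible_back:
  assumes "admissible T" "x \<in> C" "fst l \<in> I"
  shows "T x \<subseteq> push (inv_letter l) (T (act l x))"
  using admissibleD(3)[OF assms(1) act_closed[OF assms(3,2)], of "inv_letter l"] assms(3)
  by (simp add: act_inv)

lemma info_append: "info T S x (v @ w) = info T (info T S x w) (run w x) v"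
  by (induction v) (auto simp: foldr_append)

lemma info_nonempty:
  assumes "admissible T" "x \<in> C" "S \<noteq> {}" "S \<subseteq> T x" "word w"
  shows "info T S x w \<noteq> {} \<and> info T S x w \<subseteq> T (run w x)"
  using assms(5)
proof (induction w)
  case (Cons l w)
  then have w: "run w x \<in> C" "fst l \<in> I" and IH: "info T S x w \<noteq> {}" "info T S x w \<subseteq> T (run w x)"
    using assms by auto
  have "T (act l (run w x)) \<inter> push l (info T S x w) \<noteq> {}"
    using w IH admissible_back[OF assms(1)] admissibleD(1,2)[OF assms(1) act_closed]
    by (intro push_meets[of _ "T (run w x)"]) auto
  then show ?case by auto
qed (use assms in auto)

text \<open>Once nothing new is known at a point, nothing new is known further along the path.\<close>

lemma info_trivial_append:
  assumes "admissible T" "x \<in> C" "word (v @ w)" "info T S x w = T (run w x)"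
  shows "info T S x (v @ w) = T (run (v @ w) x)"
  using assms(3)
proof (induction v)
  case (Cons l v)
  then show ?case
    using assms(2) admissibleD(3)[OF assms(1), of "run (v @ w) x" l] by auto
qed (use assms in auto)

lemma info_backtrack:
  assumes "admissible T" "x \<in> C" "S \<noteq> {}" "S \<subseteq> T x" "word (inv_letter l # w)"
  shows "info T S x w \<subseteq> push l (info T S x (inv_letter l # w))"
proof -
  let ?z = "run w x"
  have z: "?z \<in> C" "fst (inv_letter l) \<in> I" "word w" using assms by auto
  note nonempty = info_nonempty[OF assms(1-4) z(3)]
  have "info T S x w \<subseteq>
      push (inv_letter (inv_letter l)) (T (act (inv_letter l) ?z) \<inter> push (inv_letter l) (info T S x w))"
    using nonempty admissibleD[OF assms(1) z(1)] admissible_back[OF assms(1) z(1,2)]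
      admissibleD[OF assms(1) act_closed[OF z(2,1)]]
    by (intro push_backtrack[of _ "T ?z"]) auto
  then show ?thesis by simp
qed

lemma info_cong:
  assumes "\<And>v. word v \<Longrightarrow> length v \<le> length w \<Longrightarrow> T (run v x) = T' (run v y)" "word w"
  shows "info T S x w = info T' S y w"
  using assms
proof (induction w)
  case (Cons l w)
  have "info T S x w = info T' S y w"
    using Cons.prems by (intro Cons.IH) auto
  moreover have "T (run (l # w) x) = T' (run (l # w) y)"
    using Cons.prems(2) by (intro Cons.prems(1)) auto
  ultimately show ?case by simp
qed simp

text \<open>Only the sets at the points visited by the path matter.\<close>

lemma info_cong_suffix:
  assumes "\<And>v u. w = u @ v \<Longrightarrow> T (run v x) = T' (run v x)"
  shows "info T S x w = info T' S x w"
  using assms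
proof (induction w)
  case (Cons l w)
  have "info T S x w = info T' S x w"
    using Cons.prems by (intro Cons.IH) auto
  moreover have "T (run (l # w) x) = T' (run (l # w) x)"
    by (intro Cons.prems[of "[]"]) auto
  ultimately show ?case by simp
qed simp

lemma eventually_run:
  assumes "x \<in> C" "word w" "\<forall>\<^sub>F y in nhds_C (run w x). P y"
  shows "\<forall>\<^sub>F z in nhds_C x. P (run w z)"
proof -
  have "isCont (run w) x"
    using continuous_run[OF assms(2)] by (simp add: continuous_on_eq_continuous_at)
  then have "filterlim (run w) (nhds (run w x)) (nhds x)"
    by (simp add: isCont_def tendsto_at_iff_tendsto_nhds)
  then have "filterlim (run w) (nhds (run w x)) (nhds_C x)"
    by (rule filterlim_mono) simp_all
  then have "filterlim (run w) (nhds_C (run w x)) (nhds_C x)"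
    using assms(2) by (simp add: filterlim_inf filterlim_principal eventually_inf_principal)
  then show ?thesis
    using assms(3) by (simp add: filterlim_iff)
qed

text \<open>If \<open>{1..r}\<close> were pushed to a proper subset, that subset would be congruent to the whole, which is
  inconsistent.\<close>

lemma admissible_full: "admissible (\<lambda>_. {1..r})"
proof -
  have "push l {1..r} = {1..r}" for l
  proof (rule ccontr)
    assume *: "push l {1..r} \<noteq> {1..r}"
    then obtain s where s: "fst l \<in> J" "{1..r} \<subseteq> side l s" "push l {1..r} = side (inv_letter l) s"
      using push_side by metis
    then have "side (inv_letter l) s \<subset> side l s"
      using * push_subset[of l "{1..r}"] by blast
    then show False
      using consistent[OF side_subset[OF s(1)]] subcongruence_side[OF s(1)] by blast
  qed
  then show ?thesis
    using r_pos by (auto simp: admissible_def simp del: One_nat_def)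
qed

text \<open>A path of length \<open>n\<close> that still carries information yields \<open>n + 1\<close> distinct subsets of \<open>{1..r}\<close>.\<close>

lemma bounded_info_full: "bounded_info (2 ^ r) (\<lambda>_. {1..r})"
  unfolding bounded_info_def
proof (intro ballI allI impI)
  fix x S w assume x: "x \<in> C" "S \<noteq> {}" "S \<subseteq> {1..r}" and w: "good w" "2 ^ r < length w"
  let ?T = "\<lambda>_. {1..r}"
  define n where "n = length w"
  \<comment> \<open>Paths are written from right to left, so \<open>D t\<close> is the information after \<open>t\<close> steps and \<open>l t\<close> the next letter.\<close>
  define D where "D t = info ?T S x (drop (n - t) w)" for t
  define l where "l t = w ! (n - Suc t)" for t
  show "info ?T S x w = {1..r}"
  proof (rule ccontr)
    assume nontriv: "info ?T S x w \<noteq> {1..r}"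
    have drop: "drop (n - Suc t) w = l t # drop (n - t) w" if "t < n" for t
      using that by (simp add: l_def n_def Cons_nth_drop_Suc[symmetric] Suc_diff_Suc)
    have word_drop: "word (drop t w)" for t
      using good_imp_word[OF w(1)] by (metis append_take_drop_id word_simps(3))
    have D: "D t \<subseteq> {1..r}" for t
      using info_nonempty[OF admissible_full x word_drop] by (simp add: D_def)
    have "D (Suc t) = push (l t) (D t) \<and> D (Suc t) \<noteq> {1..r}" if "t < n" for t
    proof
      show "D (Suc t) = push (l t) (D t)"
        using push_subset[of "l t"] by (simp add: D_def drop[OF that] Int_absorb1 del: One_nat_def)
      show "D (Suc t) \<noteq> {1..r}"
      proof
        assume "D (Suc t) = {1..r}"
        then have "info ?T S x (take (n - Suc t) w @ drop (n - Suc t) w) = {1..r}"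
          using w x by (intro info_trivial_append[OF admissible_full x(1)]) (auto simp: D_def)
        then show False using nontriv by simp
      qed
    qed
    moreover have "l (Suc t) \<noteq> inv_letter (l t)" if "Suc t < n" for t
    proof -
      have "w = take (n - Suc (Suc t)) w @ l (Suc t) # l t # drop (n - t) w"
        using drop[of "Suc t"] drop[of t] that by (metis append_take_drop_id Suc_lessD)
      then have "good (l (Suc t) # l t # drop (n - t) w)"
        using w(1) good_appendD(2) by metis
      then show ?thesis by (auto simp: good_Cons inv_letter_def)
    qed
    ultimately have "D i \<noteq> D j" if "i < j" "j \<le> n" for i j
      using that D by (intro chain_sets_distinct[of n D l i j]) blast+
    then have "inj_on D {..n}"
      by (intro linorder_inj_onI) auto
    then have "card {..n} \<le> card (Pow {1..r})"
      using D by (intro card_inj_on_le) auto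
    then show False
      using w(2) by (simp add: card_Pow n_def)
  qed
qed


section \<open>Fixing a colour on a small open set\<close>

text \<open>The consequences of giving colour \<open>k\<close> to every point of \<open>U \<inter> C\<close>.  Intersecting over all pairs
  \<open>(y, w)\<close> makes the closure properties immediate; for separated \<open>U\<close> at most one pair says more
  about a point \<open>x\<close> than \<open>T x\<close> does.\<close>

definition update :: "('a \<Rightarrow> nat set) \<Rightarrow> 'a set \<Rightarrow> nat \<Rightarrow> 'a \<Rightarrow> nat set" where
  "update T U k x =
     T x \<inter> (\<Inter>(y, w) \<in> {(y, w). y \<in> U \<inter> C \<and> good w \<and> run w y = x}. info T {k} y w)"

lemma update_subset: "update T U k x \<subseteq> T x"
  by (auto simp: update_def)

lemma update_subset_info:
  "y \<in> U \<Longrightarrow> y \<in> C \<Longrightarrow> good w \<Longrightarrow> update T U k (run w y) \<subseteq> info T {k} y w"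
  unfolding update_def by blast

text \<open>The separation \<open>6 * M + 3\<close> is what \<open>update_bounded_info\<close> needs: there, points of \<open>U\<close> are joined by
  a path of length at most \<open>4 * M + 3\<close> with detours of length at most \<open>M\<close> at either end.\<close>

context
  fixes T :: "'a \<Rightarrow> nat set" and M k :: nat and U :: "'a set"
  assumes adm: "admissible T" and bdd: "bounded_info M T"
    and sep: "separated (6 * M + 3) U" and k: "\<And>y. y \<in> U \<Longrightarrow> y \<in> C \<Longrightarrow> k \<in> T y"
begin

lemma separated_eq:
  assumes "y \<in> U" "y' \<in> U" "y \<in> C" "word v" "word w" "run v y = run w y'"
    "length v + length w \<le> 6 * M + 3"
  shows "y = y'"
proof -
  have y': "run (inv_word w @ v) y = y'"
    using assms by (simp add: foldr_append)
  moreover have "word (inv_word w @ v)" "length (inv_word w @ v) \<le> 6 * M + 3"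
    using assms by auto
  ultimately show ?thesis
    using sep assms(1-3) unfolding separated_def by (metis IntI)
qed

text \<open>Two pairs \<open>(y, w)\<close> and \<open>(y', w')\<close> that both carry information to \<open>x\<close> have words of length at most
  \<open>M\<close>; so \<open>y = y'\<close> by separation, and then \<open>w = w'\<close> by freeness.\<close>

lemma update_cases:
  assumes "x \<in> C"
  obtains (unchanged) "update T U k x = T x"
  | (changed) y w where "y \<in> U" "y \<in> C" "good w" "length w \<le> M" "run w y = x"
      "update T U k x = info T {k} y w"
proof (cases "\<forall>y\<in>U \<inter> C. \<forall>w. good w \<longrightarrow> run w y = x \<longrightarrow> info T {k} y w = T x")
  case True
  then have "update T U k x = T x" by (auto simp: update_def)
  then show ?thesis by (rule unchanged)
next
  case False
  then obtain y w where yw: "y \<in> U" "y \<in> C" "good w" "run w y = x" "info T {k} y w \<noteq> T x"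
    by blast
  have short: "length w' \<le> M"
    if "y' \<in> U" "y' \<in> C" "good w'" "run w' y' = x" "info T {k} y' w' \<noteq> T x" for y' w'
  proof (rule ccontr)
    assume "\<not> length w' \<le> M"
    then have "info T {k} y' w' = T (run w' y')"
      using bdd k[OF that(1,2)] that(2,3) unfolding bounded_info_def by auto
    then show False using that by simp
  qed
  have "info T {k} y' w' = T x \<or> y' = y \<and> w' = w"
    if y': "y' \<in> U" "y' \<in> C" "good w'" "run w' y' = x" for y' w'
  proof (rule disjCI)
    assume "\<not> (y' = y \<and> w' = w)"
    moreover have "y' = y \<and> w' = w" if "info T {k} y' w' \<noteq> T x"
    proof -
      have "length w' + length w \<le> 6 * M + 3"
        using short[OF y' that] short[OF yw] by simp
      then have "y' = y"
        using separated_eq[of y' y w' w] yw(1-4) y' by (metis good_imp_word)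
      then show ?thesis
        using run_good_unique[of w' w y] yw y' by auto
    qed
    ultimately show "info T {k} y' w' = T x" by blast
  qed
  then have "T x \<inter> info T {k} y w \<subseteq> update T U k x"
    unfolding update_def by blast
  moreover have "info T {k} y w \<subseteq> T x"
    using info_nonempty[OF adm yw(2), of "{k}" w] k[OF yw(1,2)] yw by auto
  moreover have "update T U k x \<subseteq> info T {k} y w"
    using update_subset_info[OF yw(1-3), of T k] yw(4) by simp
  ultimately have "update T U k x = info T {k} y w" by blast
  then show ?thesis using changed[OF yw(1-3) short[OF yw] yw(4)] by simp
qed

text \<open>If \<open>x\<close> is reached from \<open>y\<close> along \<open>w\<close>, a neighbour of \<open>x\<close> is either one step further along, where
  the condition holds by the definition of \<open>info\<close>, or one step back, where \<open>info_backtrack\<close> gives it.\<close>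

lemma update_admissible: "admissible (update T U k)"
  unfolding admissible_def
proof (intro ballI conjI allI impI)
  fix x assume x: "x \<in> C"
  show "update T U k x \<noteq> {}"
    using x
  proof (cases rule: update_cases)
    case (changed y w)
    then show ?thesis using info_nonempty[OF adm, of y "{k}" w] k by auto
  qed (use admissibleD[OF adm x] in auto)
  show "update T U k x \<subseteq> {1..r}"
    using update_subset admissibleD(2)[OF adm x] by (rule order_trans)
  fix l :: "nat \<times> bool" assume l: "fst l \<in> I"
  show "update T U k (act l x) \<subseteq> push l (update T U k x)"
    using x
  proof (cases rule: update_cases)
    case unchanged
    then show ?thesis
      using admissibleD(3)[OF adm x l] update_subset by fastforce
  next
    case (changed y w)
    show ?thesis
    proof (cases "good (l # w)")
      case True
      then show ?thesis
        using update_subset_info[OF changed(1,2) True, of T k] changed by auto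
    next
      case False
      then obtain v where v: "w = inv_letter l # v"
        using changed(3) l by (cases w) (auto simp: good_Cons)
      then have "good v" "run v y = act l x"
        using changed(3,5) l by (auto simp: good_Cons act_inv')
      then have "update T U k (act l x) \<subseteq> info T {k} y v"
        using update_subset_info[OF changed(1,2)] by metis
      also have "\<dots> \<subseteq> push l (info T {k} y w)"
        using info_backtrack[OF adm changed(2), of "{k}" l v] k[OF changed(1,2)] good_imp_word[OF changed(3)] v
        by (simp del: info.simps)
      finally show ?thesis using changed(6) by simp
    qed
  qed
qed

lemma update_on: "y \<in> U \<Longrightarrow> y \<in> C \<Longrightarrow> update T U k y = {k}"
  using update_subset_info[of y U "[]" T k] admissibleD(1)[OF update_admissible, of y] by auto

lemma update_neq:
  assumes "x \<in> C" "update T U k x \<noteq> T x"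
  shows "\<exists>y\<in>U \<inter> C. \<exists>w. good w \<and> length w \<le> M \<and> run w y = x"
  using assms by (cases rule: update_cases) auto

lemma update_changed_on_long_path:
  assumes "x \<in> C" "S \<noteq> {}" "S \<subseteq> update T U k x" "good w" "M < length w"
    "info (update T U k) S x w \<noteq> update T U k (run w x)"
  obtains u v where "w = u @ v" "update T U k (run v x) \<noteq> T (run v x)"
proof (rule ccontr)
  assume "\<not> thesis"
  then have same: "\<And>v u. w = u @ v \<Longrightarrow> update T U k (run v x) = T (run v x)"
    using that by metis
  have "info (update T U k) S x w = info T S x w"
    using same by (rule info_cong_suffix)
  also have "\<dots> = T (run w x)"
    using bdd assms update_subset[of T U k x] unfolding bounded_info_def by (metis order_trans)
  also have "\<dots> = update T U k (run w x)"
    using same[of "[]" w] by simp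
  finally show False using assms by simp
qed

text \<open>A path of length \<open>4 * M + 3\<close> that carries information for the updated sets must meet changed points
  both among its first and among its last \<open>M + 1\<close> steps, because a stretch of unchanged points of
  that length carries none.  Each of these two points is within distance \<open>M\<close> of \<open>U\<close>, and by
  separation of the same point of \<open>U\<close>.  So they are at distance at most \<open>2 * M\<close>, whereas the part of
  the path between them is reduced and has length at least \<open>2 * M + 1\<close>.\<close>

lemma update_bounded_info: "bounded_info (4 * M + 2) (update T U k)"
  unfolding bounded_info_def
proof (intro ballI allI impI, rule ccontr)
  let ?T = "update T U k"
  fix x S w
  assume x: "x \<in> C" and S: "S \<noteq> {}" "S \<subseteq> ?T x" and w: "good w" "4 * M + 2 < length w"
    and nontriv: "info ?T S x w \<noteq> ?T (run w x)"
  \<comment> \<open>The initial stretch \<open>w'\<close> of the path is cut into pieces \<open>a\<close>, \<open>b\<close>, \<open>c\<close>, traversed in this order.\<close>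
  define w' where "w' = drop (length w - (4 * M + 3)) w"
  define a where "a = drop (3 * M + 2) w'"
  define b where "b = drop (M + 1) (take (3 * M + 2) w')"
  define c where "c = take (M + 1) w'"
  have len: "length w' = 4 * M + 3" "length a = M + 1" "length b = 2 * M + 1" "length c = M + 1"
    using w by (auto simp: w'_def a_def b_def c_def)
  have "c = take (M + 1) (take (3 * M + 2) w')"
    by (simp add: c_def min_def)
  then have w': "w' = c @ b @ a"
    unfolding a_def b_def by (metis append.assoc append_take_drop_id)
  have "w = take (length w - (4 * M + 3)) w @ w'"
    by (simp add: w'_def)
  then obtain e where e: "w = e @ c @ b @ a"
    using w' by metis
  have good: "good a" "good b" "good c" "good (c @ b @ a)"
    using w e good_appendD by metis+
  have nontriv': "info ?T S x v \<noteq> ?T (run v x)" if "w = u @ v" for u v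
    using info_trivial_append[OF update_admissible x, of u v S] nontriv good_imp_word[OF w(1)] that
    by metis
  obtain a2 a1 where a: "a = a2 @ a1" "?T (run a1 x) \<noteq> T (run a1 x)"
    using update_changed_on_long_path[OF x S good(1)] nontriv'[of "e @ c @ b" a] e len by auto
  define z where "z = run (b @ a) x"
  define S' where "S' = info ?T S x (b @ a)"
  have z: "z \<in> C" "S' \<noteq> {}" "S' \<subseteq> ?T z"
    using info_nonempty[OF update_admissible x S, of "b @ a"] good x by (auto simp: z_def S'_def)
  have "info ?T S' z c \<noteq> ?T (run c z)"
    using nontriv'[of e "c @ b @ a"] e by (simp add: S'_def z_def info_append foldr_append)
  then obtain c2 c1 where c: "c = c2 @ c1" "?T (run c1 z) \<noteq> T (run c1 z)"
    using update_changed_on_long_path[OF z good(3)] len by auto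
  define p where "p = run a1 x"
  have p: "p \<in> C" "?T p \<noteq> T p"
    using a x good_imp_word[OF good(1)] by (simp_all add: p_def)
  define v where "v = c1 @ b @ a2"
  have v: "run c1 z = run v p"
    by (simp add: v_def p_def z_def a foldr_append)
  have good_v: "good v"
    using good(4) good_appendD[of c2 "v @ a1"] good_appendD[of v a1] by (simp add: v_def a c)
  have len_v: "2 * M + 1 \<le> length v" "length v \<le> 4 * M + 3"
    using len a c by (auto simp: v_def)
  obtain y h where y: "y \<in> U" "y \<in> C" "good h" "length h \<le> M" "run h y = p"
    using update_neq[OF p] by auto
  obtain y' h' where y': "y' \<in> U" "y' \<in> C" "good h'" "length h' \<le> M" "run h' y' = run v p"
    using update_neq[of "run v p"] p good_v c v by auto
  have "y = y'"
    using y y' len_v good_v by (intro separated_eq[of y y' "v @ h" h']) (auto simp: foldr_append)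
  then have "run v p = run (h' @ inv_word h) p"
    using y y' by (auto simp: foldr_append)
  then have "length v \<le> length (h' @ inv_word h)"
    using good_v p y y' by (intro good_length_le[of _ _ p]) auto
  then show False using y y' len_v by simp
qed

text \<open>Only finitely many words matter for the updated set at a point, as local constancy requires.\<close>

lemma update_eq_short:
  assumes "x \<in> C"
  shows "update T U k x =
    T x \<inter> (\<Inter>w \<in> {w. good w \<and> length w \<le> M \<and> run (inv_word w) x \<in> U}. info T {k} (run (inv_word w) x) w)"
    (is "_ = ?rhs")
proof
  have "update T U k x \<subseteq> info T {k} (run (inv_word w) x) w"
    if "good w" "run (inv_word w) x \<in> U" for w
  proof -
    have "run w (run (inv_word w) x) = x"
      using run_inv_word[of "inv_word w" x] that by simp
    then show ?thesis
      using update_subset_info[OF that(2) _ that(1), of T k] that assms by auto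
  qed
  then show "update T U k x \<subseteq> ?rhs"
    using update_subset by blast
  show "?rhs \<subseteq> update T U k x"
    using assms
  proof (cases rule: update_cases)
    case (changed y w)
    then have "run (inv_word w) x = y" by auto
    then show ?thesis using changed by blast
  qed auto
qed

lemma update_locally_constant:
  assumes "locally_constant T" "\<forall>z\<in>C. \<forall>\<^sub>F y in nhds_C z. y \<in> U \<longleftrightarrow> z \<in> U"
  shows "locally_constant (update T U k)"
  unfolding locally_constant_def
proof
  fix x assume x: "x \<in> C"
  have "\<forall>\<^sub>F z in nhds_C x. \<forall>v\<in>{v. word v \<and> length v \<le> 2 * M}. T (run v z) = T (run v x)"
    using assms(1) x
    by (intro eventually_ball_finite finite_short_words ballI eventually_run)
      (auto simp: locally_constant_def)
  moreover have "\<forall>\<^sub>F z in nhds_C x. \<forall>v\<in>{v. word v \<and> length v \<le> 2 * M}. run v z \<in> U \<longleftrightarrow> run v x \<in> U"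
    using assms(2) x
    by (intro eventually_ball_finite finite_short_words ballI eventually_run) auto
  moreover have "\<forall>\<^sub>F z in nhds_C x. z \<in> C"
    by (simp add: eventually_inf_principal)
  ultimately show "\<forall>\<^sub>F z in nhds_C x. update T U k z = update T U k x"
  proof eventually_elim
    case (elim z)
    have T: "T (run v z) = T (run v x)" and U: "run v z \<in> U \<longleftrightarrow> run v x \<in> U"
      if "word v" "length v \<le> 2 * M" for v
      using elim that by auto
    have "info T {k} (run (inv_word w) z) w = info T {k} (run (inv_word w) x) w"
      if w: "good w" "length w \<le> M" for w
    proof (rule info_cong)
      fix v assume "word v" "length v \<le> length w"
      then show "T (run v (run (inv_word w) z)) = T (run v (run (inv_word w) x))"
        using w T[of "v @ inv_word w"] by (simp add: foldr_append)
    qed (use w in auto)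
    moreover have "run (inv_word w) z \<in> U \<longleftrightarrow> run (inv_word w) x \<in> U"
      if "good w" "length w \<le> M" for w
      using U[of "inv_word w"] that by auto
    moreover have "T z = T x"
      using T[of "[]"] by simp
    ultimately show ?case
      using x elim by (auto simp: update_eq_short)
  qed
qed

end

section \<open>The construction of the colouring\<close>

text \<open>A word fixing \<open>y\<close> acts as the identity, by freeness; any other word moves \<open>y\<close> off a neighbourhood.\<close>

lemma separating_nbhd:
  assumes "word w" "y \<in> C"
  shows "\<exists>W. open W \<and> y \<in> W \<and> (\<forall>u\<in>W. run w u \<in> W \<longrightarrow> run w u = u)"
proof (cases "run w y = y")
  case True
  obtain v where v: "good v" "\<And>x. run v x = run w x"
    using reduce_word[OF assms(1)] by metis
  then have "v = []"
    using run_good_unique[of v "[]" y] True assms by simp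
  then show ?thesis
    using v(2) by (intro exI[of _ UNIV]) (metis UNIV_I foldr.simps(1) id_apply open_UNIV)
next
  case False
  then obtain A B where AB: "open A" "open B" "y \<in> A" "run w y \<in> B" "A \<inter> B = {}"
    using hausdorff[of y "run w y"] by metis
  then show ?thesis
    using continuous_run[OF assms(1)]
    by (intro exI[of _ "A \<inter> run w -` B"]) (auto intro: open_vimage)
qed

lemma separated_nbhd:
  assumes "y \<in> C" "open V" "y \<in> V"
  shows "\<exists>U. open U \<and> y \<in> U \<and> U \<subseteq> V \<and> separated d U \<and>
    (\<forall>z\<in>C. \<forall>\<^sub>F y in nhds_C z. y \<in> U \<longleftrightarrow> z \<in> U)"
proof -
  obtain W where W: "\<And>w. word w \<Longrightarrow> open (W w) \<and> y \<in> W w \<and> (\<forall>u\<in>W w. run w u \<in> W w \<longrightarrow> run w u = u)"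
    using separating_nbhd[OF _ assms(1)] by metis
  let ?V = "V \<inter> (\<Inter>w\<in>{w. word w \<and> length w \<le> d}. W w)"
  have "open ?V"
    using W assms by (intro open_Int open_INT finite_short_words) auto
  moreover have "y \<in> ?V" using W assms by auto
  ultimately obtain U where U: "open U" "y \<in> U" "U \<subseteq> ?V"
      "\<forall>z\<in>C. \<forall>\<^sub>F y in nhds_C z. y \<in> U \<longleftrightarrow> z \<in> U"
    using small_clopen[of ?V y] assms(1) by blast
  have "separated d U"
    unfolding separated_def
  proof (intro ballI allI impI)
    fix u w assume "u \<in> U \<inter> C" "word w" "length w \<le> d" "run w u \<in> U"
    then show "run w u = u"
      using U(3) W[of w] by blast
  qed
  then show ?thesis using U by blast
qed

lemma separated_mono: "separated d U \<Longrightarrow> d' \<le> d \<Longrightarrow> separated d' U"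
  unfolding separated_def by (meson order_trans)

definition tame :: "nat \<Rightarrow> ('a \<Rightarrow> nat set) \<Rightarrow> bool" where
  "tame M T \<longleftrightarrow> admissible T \<and> bounded_info M T \<and> locally_constant T"

lemma tame_full: "tame (2 ^ r) (\<lambda>_. {1..r})"
  using admissible_full bounded_info_full by (simp add: tame_def locally_constant_def)

text \<open>Near \<open>y\<close> the sets \<open>T\<close> are constant, so \<open>k\<close> is permitted on a whole neighbourhood; the update on a
  smaller, separated neighbourhood then applies.  The further separation \<open>d\<close> is free for the caller.\<close>

lemma tame_extend:
  assumes T: "tame M T" and y: "y \<in> C" "k \<in> T y" "open V" "y \<in> V"
  obtains T' U where "tame (4 * M + 2) T'" "\<And>x. T' x \<subseteq> T x"
    "open U" "y \<in> U" "U \<subseteq> V" "separated d U" "\<And>x. x \<in> U \<Longrightarrow> x \<in> C \<Longrightarrow> T' x = {k}"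
    "\<And>x. x \<in> C \<Longrightarrow> T' x \<noteq> T x \<Longrightarrow> \<exists>u\<in>U \<inter> C. \<exists>w. good w \<and> length w \<le> M \<and> run w u = x"
proof -
  have "\<forall>\<^sub>F z in nhds_C y. T z = T y"
    using T y(1) by (simp add: tame_def locally_constant_def)
  then obtain W where W: "open W" "y \<in> W" "\<And>z. z \<in> W \<Longrightarrow> z \<in> C \<Longrightarrow> T z = T y"
    unfolding eventually_inf_principal eventually_nhds by blast
  obtain U where U: "open U" "y \<in> U" "U \<subseteq> V \<inter> W" "separated (max d (6 * M + 3)) U"
      "\<forall>z\<in>C. \<forall>\<^sub>F y in nhds_C z. y \<in> U \<longleftrightarrow> z \<in> U"
    using separated_nbhd[of y "V \<inter> W" "max d (6 * M + 3)", OF y(1)] y(3,4) W(1,2) by blast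
  have sep: "separated d U" "separated (6 * M + 3) U"
    using separated_mono[OF U(4)] by auto
  have k: "k \<in> T u" if "u \<in> U" "u \<in> C" for u
    using W(3)[of u] that U(3) y(2) by auto
  have adm: "admissible T" and bdd: "bounded_info M T" and lc: "locally_constant T"
    using T by (auto simp: tame_def)
  note hyps = adm bdd sep(2) k
  show ?thesis
  proof (rule that[of "update T U k" U])
    show "tame (4 * M + 2) (update T U k)"
      using update_admissible[OF hyps] update_bounded_info[OF hyps]
        update_locally_constant[OF hyps lc U(5)] by (simp add: tame_def)
    show "U \<subseteq> V" using U(3) by simp
  qed (use U(1,2) sep(1) update_subset update_on[OF hyps] update_neq[OF hyps] in auto)
qed

text \<open>Every colour can be used at least once because some region of an orbit is kept free of
  restrictions.  The bound \<open>M\<close> is chosen before the radius \<open>K\<close> of that region, since the region needed at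
  one stage depends on the bound reached at that stage.\<close>

lemma initial_colours:
  assumes "j \<le> r"
  shows "\<exists>M. \<forall>K. \<exists>T. tame M T \<and> (\<forall>k\<in>{1..j}. \<exists>x\<in>C. T x = {k}) \<and>
    (\<exists>x\<in>C. \<forall>w. word w \<longrightarrow> length w \<le> K \<longrightarrow> T (run w x) = {1..r})"
  using assms
proof (induction j)
  case 0
  have "C \<noteq> {}"
    using comeager_imp_meets_open[OF comeager_C, of UNIV] by auto
  then show ?case
    using tame_full by (intro exI[of _ "2 ^ r"]) auto
next
  case (Suc j)
  then obtain M where M: "\<And>K. \<exists>T. tame M T \<and> (\<forall>k\<in>{1..j}. \<exists>x\<in>C. T x = {k}) \<and>
    (\<exists>x\<in>C. \<forall>w. word w \<longrightarrow> length w \<le> K \<longrightarrow> T (run w x) = {1..r})"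
    by auto
  have "\<exists>T. tame (4 * M + 2) T \<and> (\<forall>k\<in>{1..Suc j}. \<exists>x\<in>C. T x = {k}) \<and>
    (\<exists>x\<in>C. \<forall>w. word w \<longrightarrow> length w \<le> K \<longrightarrow> T (run w x) = {1..r})" for K
  proof -
    obtain i where i: "i \<in> I" using I_nonempty by blast
    \<comment> \<open>Colour the centre \<open>x\<close> of a larger free region; the translate of \<open>x\<close> by \<open>s\<close> steps is too far from \<open>x\<close> for its \<open>K\<close>-ball to be affected.\<close>
    define s where "s = K + M + 1"
    define p where "p = replicate s (i, True)"
    have "reduced_word p"
      unfolding p_def
    proof (induction s)
      case (Suc s)
      then show ?case by (cases s) (auto simp: reduced_word_Cons inv_letter_def)
    qed simp
    then have p: "good p" "length p = s"
      using i by (auto simp: good_def word_def p_def)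
    obtain T where T: "tame M T" "\<forall>k\<in>{1..j}. \<exists>x\<in>C. T x = {k}"
      and "\<exists>x\<in>C. \<forall>w. word w \<longrightarrow> length w \<le> K + s \<longrightarrow> T (run w x) = {1..r}"
      using M[of "K + s"] by (elim exE conjE)
    then obtain x where x: "x \<in> C"
      and full: "\<And>w. word w \<Longrightarrow> length w \<le> K + s \<Longrightarrow> T (run w x) = {1..r}"
      by blast
    have "Suc j \<in> T x"
      using full[of "[]"] Suc.prems by simp
    then obtain T' U where T': "tame (4 * M + 2) T'" "\<And>x. T' x \<subseteq> T x"
      "open U" "x \<in> U" "U \<subseteq> UNIV" "separated (M + K + s) U" "\<And>x. x \<in> U \<Longrightarrow> x \<in> C \<Longrightarrow> T' x = {Suc j}"
      "\<And>x. x \<in> C \<Longrightarrow> T' x \<noteq> T x \<Longrightarrow> \<exists>u\<in>U \<inter> C. \<exists>w. good w \<and> length w \<le> M \<and> run w u = x"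
      using tame_extend[OF T(1) x _ open_UNIV, of "Suc j" "M + K + s"] by blast
    have "T' (run w (run p x)) = {1..r}" if w: "word w" "length w \<le> K" for w
    proof (rule ccontr)
      assume *: "T' (run w (run p x)) \<noteq> {1..r}"
      have "T (run w (run p x)) = {1..r}"
        using full[of "w @ p"] w p by (simp add: foldr_append)
      then obtain u h where u: "u \<in> U" "u \<in> C" "good h" "length h \<le> M" "run h u = run w (run p x)"
        using T'(8)[of "run w (run p x)"] * x w p by auto
      define v where "v = inv_word h @ w @ p"
      have "run v x = u"
        using u(3) by (simp add: v_def foldr_append u(5)[symmetric])
      moreover have "word v" "length v \<le> M + K + s"
        using u w p by (auto simp: v_def)
      ultimately have "u = x"
        using T'(4,6) x u(1) unfolding separated_def by blast
      then have "run p x = run (inv_word w @ h) x"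
        using u w by (simp add: foldr_append)
      then have "length p \<le> length (inv_word w @ h)"
        using p x u w by (intro good_length_le) auto
      then show False
        using p u w by (simp add: s_def)
    qed
    moreover have "\<exists>x\<in>C. T' x = {k}" if k: "k \<in> {1..Suc j}" for k
    proof (cases "k = Suc j")
      case True
      then show ?thesis using T'(4,7) x by blast
    next
      case False
      then have "k \<in> {1..j}" using k by auto
      then obtain z where z: "z \<in> C" "T z = {k}"
        using T(2) by blast
      then have "T' z = {k}"
        using T'(2)[of z] admissibleD(1)[of T' z] T'(1) by (auto simp: tame_def)
      then show ?thesis using z by blast
    qed
    moreover have "run p x \<in> C" using p x by simp
    ultimately show ?thesis
      using T'(1) by blast
  qed
  then show ?case by blast
qed

lemma refining_sequence:
  obtains T :: "nat \<Rightarrow> 'a \<Rightarrow> nat set" where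
    "\<And>n. \<exists>M. tame M (T n)" "\<And>n x. T (Suc n) x \<subseteq> T n x"
    "\<And>k. k \<in> {1..r} \<Longrightarrow> \<exists>x\<in>C. T 0 x = {k}"
    "\<And>V. open V \<Longrightarrow> V \<noteq> {} \<Longrightarrow>
       \<exists>n k U. open U \<and> U \<noteq> {} \<and> U \<subseteq> V \<and> (\<forall>x\<in>U \<inter> C. T n x = {k})"
proof -
  obtain \<B> :: "'a set set" where \<B>: "countable \<B>" "topological_basis \<B>"
    using ex_countable_basis by blast
  have "\<B> \<noteq> {}"
    using topological_basisE[OF \<B>(2) open_UNIV UNIV_I] by blast
  define B where "B = from_nat_into \<B>"
  have B: "open (B n)" for n
    using from_nat_into[OF \<open>\<B> \<noteq> {}\<close>] topological_basis_open[OF \<B>(2)] by (simp add: B_def)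
  have B_small: "\<exists>n. x \<in> B n \<and> B n \<subseteq> V" if V: "open V" "x \<in> V" for V x
    using topological_basisE[OF \<B>(2) V] from_nat_into_surj[OF \<B>(1)] unfolding B_def by metis
  obtain M0 where "\<forall>K. \<exists>T. tame M0 T \<and> (\<forall>k\<in>{1..r}. \<exists>x\<in>C. T x = {k}) \<and>
    (\<exists>x\<in>C. \<forall>w. word w \<longrightarrow> length w \<le> K \<longrightarrow> T (run w x) = {1..r})"
    using initial_colours[OF order_refl] by (elim exE)
  from this[rule_format, of 0] obtain T0 where T0: "tame M0 T0" "\<forall>k\<in>{1..r}. \<exists>x\<in>C. T0 x = {k}"
    by (elim exE conjE)
  define P where "P n T \<longleftrightarrow> (\<exists>M. tame M T) \<and> (n = 0 \<longrightarrow> T = T0)" for n :: nat and T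
  define Q where "Q n T T' \<longleftrightarrow> (\<forall>x. T' x \<subseteq> T x) \<and> (B n \<noteq> {} \<longrightarrow>
    (\<exists>k U. open U \<and> U \<noteq> {} \<and> U \<subseteq> B n \<and> (\<forall>x\<in>U \<inter> C. T' x = {k})))"
    for n and T T' :: "'a \<Rightarrow> nat set"
  have "\<exists>T. P 0 T"
    using T0 by (auto simp: P_def)
  moreover have "\<exists>T'. P (Suc n) T' \<and> Q n T T'" if PT: "P n T" for n T
  proof (cases "B n = {}")
    case True
    then show ?thesis
      using PT by (intro exI[of _ T]) (auto simp: P_def Q_def)
  next
    case False
    obtain M where M: "tame M T" using PT by (auto simp: P_def)
    obtain y where y: "y \<in> B n" "y \<in> C"
      using comeager_imp_meets_open[OF comeager_C B False] by blast
    obtain k where k: "k \<in> T y"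
      using M y admissibleD(1)[of T y] by (auto simp: tame_def)
    obtain T' U where T': "tame (4 * M + 2) T'" "\<And>x. T' x \<subseteq> T x"
      "open U" "y \<in> U" "U \<subseteq> B n" "\<And>x. x \<in> U \<Longrightarrow> x \<in> C \<Longrightarrow> T' x = {k}"
      by (rule tame_extend[OF M y(2) k B y(1), where d = 0]) (rule that; assumption)
    have "P (Suc n) T'"
      unfolding P_def using T'(1) by auto
    moreover have "Q n T T'"
      unfolding Q_def using T'(2-6) by (intro conjI allI impI exI[of _ k] exI[of _ U]) auto
    ultimately show ?thesis by blast
  qed
  ultimately have "\<exists>T. \<forall>n. P n (T n) \<and> Q n (T n) (T (Suc n))"
    by (rule dependent_nat_choice)
  then obtain T where T: "\<forall>n. P n (T n) \<and> Q n (T n) (T (Suc n))"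
    by (elim exE)
  show ?thesis
  proof (rule that[of T])
    show "\<exists>M. tame M (T n)" "T (Suc n) x \<subseteq> T n x" for n x
      using T by (auto simp: P_def Q_def)
    show "\<exists>x\<in>C. T 0 x = {k}" if "k \<in> {1..r}" for k
      using T T0(2) that unfolding P_def by metis
    fix V :: "'a set" assume "open V" "V \<noteq> {}"
    then obtain n where "B n \<noteq> {}" "B n \<subseteq> V"
      using B_small by blast
    then show "\<exists>n k U. open U \<and> U \<noteq> {} \<and> U \<subseteq> V \<and> (\<forall>x\<in>U \<inter> C. T n x = {k})"
      using T unfolding Q_def by (meson order_trans)
  qed
qed

text \<open>Permitted sets decrease and stay nonempty, so once a singleton they remain so.  The set \<open>A k\<close>
  collects the open sets on which the colour \<open>k\<close> has been settled; admissibility of two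
  singletons at neighbouring points is precisely the congruence condition.\<close>

lemma open_quasi_solution:
  obtains A :: "nat \<Rightarrow> 'a set" where
    "\<And>k. open (A k)" "\<And>k. k \<in> {1..r} \<Longrightarrow> A k \<noteq> {}" "comeager (\<Union>k\<in>{1..r}. A k)"
    "\<And>x j k. x \<in> C \<Longrightarrow> x \<in> A j \<Longrightarrow> x \<in> A k \<Longrightarrow> j = k"
    "\<And>x i j k. i \<in> I \<Longrightarrow> i \<in> J \<Longrightarrow> x \<in> C \<Longrightarrow> x \<in> A j \<Longrightarrow> act (i, True) x \<in> A k \<Longrightarrow>
       j \<in> L i \<longleftrightarrow> k \<in> R i"
proof -
  obtain T :: "nat \<Rightarrow> 'a \<Rightarrow> nat set" where
    T: "\<And>n. \<exists>M. tame M (T n)" "\<And>n x. T (Suc n) x \<subseteq> T n x"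
      "\<And>k. k \<in> {1..r} \<Longrightarrow> \<exists>x\<in>C. T 0 x = {k}"
    and dense: "\<And>V. open V \<Longrightarrow> V \<noteq> {} \<Longrightarrow>
      \<exists>n k U. open U \<and> U \<noteq> {} \<and> U \<subseteq> V \<and> (\<forall>x\<in>U \<inter> C. T n x = {k})"
    using refining_sequence by metis
  have adm: "admissible (T n)" and lc: "locally_constant (T n)" for n
    using T(1)[of n] by (auto simp: tame_def)
  have decreasing: "T n x \<subseteq> T m x" if "m \<le> n" for m n x
    using lift_Suc_antimono_le[of "\<lambda>n. T n x", OF T(2) that] .
  have settled: "T n x = {k}" if "x \<in> C" "T m x = {k}" "m \<le> n" for x m n k
    using decreasing[OF that(3), of x] admissibleD(1)[OF adm that(1), of n] that(2) by auto
  define A where "A k = \<Union>{V. open V \<and> (\<exists>n. \<forall>x\<in>V \<inter> C. T n x = {k})}" for k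
  have A_eventually: "\<exists>m. \<forall>n\<ge>m. T n x = {k}" if x: "x \<in> C" "x \<in> A k" for x k
  proof -
    obtain m where "T m x = {k}"
      using x unfolding A_def by blast
    then show ?thesis using settled x by blast
  qed
  show ?thesis
  proof (rule that[of A])
    show "open (A k)" for k
      by (auto simp: A_def)
    show "A k \<noteq> {}" if k: "k \<in> {1..r}" for k
    proof -
      obtain x where x: "x \<in> C" "T 0 x = {k}"
        using T(3)[OF k] by blast
      then have "\<forall>\<^sub>F y in nhds_C x. T 0 y = {k}"
        using lc[of 0] unfolding locally_constant_def by metis
      then obtain V where "open V" "x \<in> V" "\<forall>y\<in>V \<inter> C. T 0 y = {k}"
        unfolding eventually_inf_principal eventually_nhds by blast
      then have "x \<in> A k" unfolding A_def by blast
      then show ?thesis by blast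
    qed
    show "comeager (\<Union>k\<in>{1..r}. A k)"
    proof (rule comeager_open_dense)
      show "open (\<Union>k\<in>{1..r}. A k)" by (auto simp: A_def)
      fix V :: "'a set" assume V: "open V" "V \<noteq> {}"
      obtain n k U where U: "open U" "U \<noteq> {}" "U \<subseteq> V" "\<forall>x\<in>U \<inter> C. T n x = {k}"
        using dense[OF V] by metis
      obtain x where x: "x \<in> U" "x \<in> C"
        using comeager_imp_meets_open[OF comeager_C U(1,2)] by blast
      have "k \<in> {1..r}"
        using U(4) x admissibleD(2)[OF adm x(2), of n] by auto
      moreover have "U \<subseteq> A k"
        using U unfolding A_def by blast
      ultimately show "V \<inter> (\<Union>k\<in>{1..r}. A k) \<noteq> {}"
        using U(3) x by blast
    qed
    show "j = k" if x: "x \<in> C" "x \<in> A j" "x \<in> A k" for x j k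
    proof -
      obtain m m' where "\<forall>n\<ge>m. T n x = {j}" "\<forall>n\<ge>m'. T n x = {k}"
        using A_eventually x by meson
      then have "{j} = {k}"
        by (metis max.cobounded1 max.cobounded2)
      then show ?thesis by simp
    qed
    fix x i j k
    assume i: "i \<in> I" "i \<in> J" and x: "x \<in> C" "x \<in> A j" "act (i, True) x \<in> A k"
    let ?y = "act (i, True) x"
    have y: "?y \<in> C" using act_closed i x by auto
    obtain m m' where "\<forall>n\<ge>m. T n x = {j}" "\<forall>n\<ge>m'. T n ?y = {k}"
      using A_eventually x y by meson
    then have n: "T (max m m') x = {j}" "T (max m m') ?y = {k}"
      by simp_all
    have jk: "j \<in> {1..r}" "k \<in> {1..r}"
      using n admissibleD(2)[OF adm x(1), of "max m m'"] admissibleD(2)[OF adm y, of "max m m'"]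
      by auto
    have "k \<in> push (i, True) {j}"
      using admissibleD(3)[OF adm x(1), of "(i, True)" "max m m'"] n i by simp
    then show "j \<in> L i \<longleftrightarrow> k \<in> R i"
      using i(2) jk by (auto simp: push_def side_def inv_letter_def split: if_splits)
  qed
qed

end


section \<open>Groups of homeomorphisms\<close>

lemma subgroup_homeo_group:
  assumes "subgroup G (homeo_group :: ('a::topological_space \<Rightarrow> 'a) monoid)"
  shows "id \<in> G" "g \<in> G \<Longrightarrow> h \<in> G \<Longrightarrow> g \<circ> h \<in> G"
    "g \<in> G \<Longrightarrow> inv\<^bsub>homeo_group\<lparr>carrier := G\<rparr>\<^esub> g = inv_into UNIV g"
    "g \<in> G \<Longrightarrow> inv_into UNIV g \<in> G" "g \<in> G \<Longrightarrow> homeomorphism UNIV UNIV g (inv_into UNIV g)"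
proof -
  let ?K = "homeo_group\<lparr>carrier := G\<rparr> :: ('a \<Rightarrow> 'a) monoid"
  interpret K: group ?K
    using subgroup.subgroup_is_group[OF assms group_homeo_group] .
  show "id \<in> G" and "g \<in> G \<Longrightarrow> h \<in> G \<Longrightarrow> g \<circ> h \<in> G"
    using K.one_closed K.m_closed[of g h] by (auto simp: homeo_group_def)
  assume g: "g \<in> G"
  have "g \<circ> inv\<^bsub>?K\<^esub> g = id" "inv\<^bsub>?K\<^esub> g \<circ> g = id"
    using K.r_inv[of g] K.l_inv[of g] g by (auto simp: homeo_group_def)
  then show eq: "inv\<^bsub>?K\<^esub> g = inv_into UNIV g"
    using inv_unique_comp by metis
  show "inv_into UNIV g \<in> G"
    using K.inv_closed[of g] g eq by simp
  obtain h where h: "homeomorphism UNIV UNIV g h"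
    using subgroup.subset[OF assms] g by (auto simp: homeo_group_def)
  then have "inv_into UNIV g = h"
    by (intro inv_unique_comp) (auto simp: homeomorphism_def fun_eq_iff)
  then show "homeomorphism UNIV UNIV g (inv_into UNIV g)"
    using h by simp
qed

text \<open>Removing from a free comeager set the orbits of the frontiers of all basic open sets leaves a
  comeager invariant set in which the basic open sets are clopen.\<close>

lemma free_clopen_comeager_set:
  fixes G :: "('a::polish_space \<Rightarrow> 'a) set"
  assumes G: "subgroup G homeo_group" and "countable G" and "acts_freely_on_comeager G"
  obtains C where "comeager C" "\<And>g x. g \<in> G \<Longrightarrow> x \<in> C \<Longrightarrow> g x \<in> C"
    "\<And>g x. g \<in> G \<Longrightarrow> g \<noteq> id \<Longrightarrow> x \<in> C \<Longrightarrow> g x \<noteq> x"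
    "\<And>V x. open V \<Longrightarrow> x \<in> V \<Longrightarrow> x \<in> C \<Longrightarrow>
      \<exists>U. open U \<and> x \<in> U \<and> U \<subseteq> V \<and>
        (\<forall>z\<in>C. \<forall>\<^sub>F y in inf (nhds z) (principal C). y \<in> U \<longleftrightarrow> z \<in> U)"
proof -
  obtain C0 where C0: "comeager C0" "\<forall>g\<in>G. g ` C0 = C0" "\<forall>g\<in>G. g \<noteq> id \<longrightarrow> (\<forall>x\<in>C0. g x \<noteq> x)"
    using assms(3) unfolding acts_freely_on_comeager_def by metis
  obtain \<B> :: "'a set set" where \<B>: "countable \<B>" "topological_basis \<B>"
    using ex_countable_basis by blast
  define N where "N = (\<Union>g\<in>G. \<Union>B\<in>\<B>. g -` frontier B)"
  have "meager N"
    unfolding N_def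
  proof (intro meager_UN assms(2) \<B>(1))
    fix g B assume "g \<in> G" "B \<in> \<B>"
    then show "meager (g -` frontier B)"
      using subgroup_homeo_group(5)[OF G] nowhere_dense_frontier topological_basis_open[OF \<B>(2)]
      by (metis meager_vimage nowhere_dense_imp_meager)
  qed
  then have "comeager (C0 - N)"
    using C0(1) meager_Un unfolding comeager_def by (simp add: Compl_Diff_eq Un_commute)
  moreover have "g x \<in> C0 - N" if "g \<in> G" "x \<in> C0 - N" for g x
  proof -
    have "g x \<notin> N"
    proof
      assume "g x \<in> N"
      then obtain h B where "h \<in> G" "B \<in> \<B>" "(h \<circ> g) x \<in> frontier B"
        by (auto simp: N_def)
      then have "x \<in> N"
        using subgroup_homeo_group(2)[OF G, of h g] that(1) unfolding N_def by blast
      then show False using that(2) by simp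
    qed
    then show ?thesis using C0(2) that by blast
  qed
  moreover have "\<exists>U. open U \<and> x \<in> U \<and> U \<subseteq> V \<and>
      (\<forall>z\<in>C0 - N. \<forall>\<^sub>F y in inf (nhds z) (principal (C0 - N)). y \<in> U \<longleftrightarrow> z \<in> U)"
    if V: "open V" "x \<in> V" for V x
  proof -
    obtain B where B: "B \<in> \<B>" "x \<in> B" "B \<subseteq> V"
      using topological_basisE[OF \<B>(2) V] by metis
    have "open B" using topological_basis_open[OF \<B>(2) B(1)] .
    have "\<forall>\<^sub>F y in nhds z. y \<in> B \<longleftrightarrow> z \<in> B" if "z \<in> C0 - N" for z
    proof (cases "z \<in> B")
      case True
      then show ?thesis
        using eventually_nhds_in_open[OF \<open>open B\<close> True] by simp
    next
      case False
      have "z \<notin> frontier B"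
        using that B(1) subgroup_homeo_group(1)[OF G] unfolding N_def by fastforce
      then have "z \<in> - closure B"
        using False \<open>open B\<close> by (auto simp: frontier_def interior_open)
      then have "\<forall>\<^sub>F y in nhds z. y \<in> - closure B"
        by (intro eventually_nhds_in_open) auto
      then show ?thesis
        using False closure_subset[of B] by (auto elim!: eventually_mono)
    qed
    then have "\<forall>z\<in>C0 - N. \<forall>\<^sub>F y in inf (nhds z) (principal (C0 - N)). y \<in> B \<longleftrightarrow> z \<in> B"
      unfolding eventually_inf_principal by (metis (mono_tags, lifting) eventually_mono)
    then show ?thesis using B \<open>open B\<close> by blast
  qed
  ultimately show ?thesis
    using that[of "C0 - N"] C0(3) by blast
qed

text \<open>The congruence of \<open>S\<close> to \<open>T\<close> via \<open>\<sigma>\<close>, for the colour classes of \<open>\<kappa>\<close> on an invariant set \<open>E\<close>, without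
  meager exceptions.\<close>

definition tracks :: "'a set \<Rightarrow> ('a \<Rightarrow> nat) \<Rightarrow> ('a \<Rightarrow> 'a) \<Rightarrow> nat set \<Rightarrow> nat set \<Rightarrow> bool" where
  "tracks E \<kappa> \<sigma> S T \<longleftrightarrow> (\<forall>x\<in>E. \<kappa> x \<in> S \<longleftrightarrow> \<kappa> (\<sigma> x) \<in> T)"

text \<open>Deductions are realised by the group operations: symmetry by inverses, transitivity by
  composition; complementation keeps the witness.\<close>

lemma tracks_deducible:
  assumes G: "subgroup G homeo_group" and E: "\<And>g. g \<in> G \<Longrightarrow> g ` E \<subseteq> E"
    and \<kappa>: "\<kappa> ` E \<subseteq> {1..r}"
    and "\<And>S T. (S, T) \<in> Cs \<Longrightarrow> \<exists>\<sigma>\<in>G. tracks E \<kappa> \<sigma> S T"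
    and "deducible r Cs S T"
  shows "\<exists>\<sigma>\<in>G. tracks E \<kappa> \<sigma> S T"
  using assms(5)
proof (induction rule: deducible.induct)
  case (member S T)
  then show ?case using assms(4) by simp
next
  case (member_sym S T)
  then obtain \<sigma> where \<sigma>: "\<sigma> \<in> G" "tracks E \<kappa> \<sigma> S T"
    using assms(4) by blast
  have "\<sigma> (inv_into UNIV \<sigma> x) = x" for x
    using subgroup_homeo_group(5)[OF G \<sigma>(1)] by (simp add: homeomorphism_def)
  then have "tracks E \<kappa> (inv_into UNIV \<sigma>) T S"
    using \<sigma> E[OF subgroup_homeo_group(4)[OF G \<sigma>(1)]] unfolding tracks_def by (metis image_subset_iff)
  then show ?case
    using subgroup_homeo_group(4)[OF G \<sigma>(1)] by blast
next
  case (compl S T)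
  then obtain \<sigma> where "\<sigma> \<in> G" "tracks E \<kappa> \<sigma> S T" by blast
  then show ?case
    using E[of \<sigma>] \<kappa> unfolding tracks_def by (intro bexI[of _ \<sigma>]) blast+
next
  case (trans S M T)
  then obtain \<sigma> \<tau> where st: "\<sigma> \<in> G" "tracks E \<kappa> \<sigma> S M" "\<tau> \<in> G" "tracks E \<kappa> \<tau> M T"
    by blast
  then have "tracks E \<kappa> (\<tau> \<circ> \<sigma>) S T"
    using E[OF st(1)] unfolding tracks_def by (simp add: image_subset_iff)
  then show ?case
    using subgroup_homeo_group(2)[OF G st(3,1)] by blast
qed

lemma tracks_imp_quasi_congruent:
  assumes G: "subgroup G homeo_group" and \<sigma>: "\<sigma> \<in> G"
    and E: "comeager E" "\<And>g. g \<in> G \<Longrightarrow> g ` E \<subseteq> E"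
    and A: "\<And>x k. x \<in> E \<Longrightarrow> k \<in> {1..r} \<Longrightarrow> x \<in> A k \<longleftrightarrow> \<kappa> x = k"
    and "tracks E \<kappa> \<sigma> S T" "S \<subseteq> {1..r}" "T \<subseteq> {1..r}"
  shows "quasi_congruent_via \<sigma> (\<Union>k\<in>S. A k) (\<Union>k\<in>T. A k)"
  unfolding quasi_congruent_via_def
proof (rule meager_subset)
  show "meager (- E)" using E(1) by (simp add: comeager_def)
  have mem: "x \<in> (\<Union>k\<in>S. A k) \<longleftrightarrow> \<kappa> x \<in> S" if "x \<in> E" "S \<subseteq> {1..r}" for x S
    using A[OF that(1)] that(2) by blast
  have inv: "\<sigma> (inv_into UNIV \<sigma> x) = x" "inv_into UNIV \<sigma> (\<sigma> x) = x" for x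
    using subgroup_homeo_group(5)[OF G \<sigma>] by (simp_all add: homeomorphism_def)
  have "y \<in> \<sigma> ` (\<Union>k\<in>S. A k) \<longleftrightarrow> y \<in> (\<Union>k\<in>T. A k)" if y: "y \<in> E" for y
  proof -
    have x: "inv_into UNIV \<sigma> y \<in> E"
      using E(2)[OF subgroup_homeo_group(4)[OF G \<sigma>]] y by blast
    have "y \<in> \<sigma> ` (\<Union>k\<in>S. A k) \<longleftrightarrow> inv_into UNIV \<sigma> y \<in> (\<Union>k\<in>S. A k)"
      using inv by (metis (no_types, lifting) image_iff)
    also have "\<dots> \<longleftrightarrow> \<kappa> y \<in> T"
      using mem[OF x assms(7)] assms(6) x inv(1) unfolding tracks_def by metis
    also have "\<dots> \<longleftrightarrow> y \<in> (\<Union>k\<in>T. A k)"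
      using mem[OF y assms(8)] by simp
    finally show ?thesis .
  qed
  then show "sym_diff (\<sigma> ` (\<Union>k\<in>S. A k)) (\<Union>k\<in>T. A k) \<subseteq> - E" by blast
qed

text \<open>Passing to the points whose whole orbit under \<open>G\<close> is coloured turns the open sets into an honest
  colouring of a comeager \<open>G\<close>-invariant set.\<close>

lemma tracking_colouring:
  fixes G :: "('a::polish_space \<Rightarrow> 'a) set"
  assumes G: "subgroup G homeo_group" "countable G" "acts_freely_on_comeager G"
    and H: "subgroup H (homeo_group\<lparr>carrier := G\<rparr>)"
    and f: "free_generators (homeo_group\<lparr>carrier := H\<rparr>) I f"
    and I: "finite I" "I \<noteq> {}" "J \<subseteq> I"
    and forest: "congruence_forest r J L R"
  obtains A :: "nat \<Rightarrow> 'a set" and E and \<kappa> :: "'a \<Rightarrow> nat" where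
    "\<And>k. open (A k)" "\<And>k. k \<in> {1..r} \<Longrightarrow> A k \<noteq> {}"
    "comeager E" "\<And>g. g \<in> G \<Longrightarrow> g ` E \<subseteq> E"
    "\<kappa> ` E \<subseteq> {1..r}" "\<And>x k. x \<in> E \<Longrightarrow> k \<in> {1..r} \<Longrightarrow> x \<in> A k \<longleftrightarrow> \<kappa> x = k"
    "\<And>i. i \<in> J \<Longrightarrow> tracks E \<kappa> (f i) (L i) (R i)"
proof -
  have HG: "H \<subseteq> G" using subgroup.subset[OF H] by simp
  have H': "subgroup H homeo_group"
    using group.incl_subgroup[OF group_homeo_group G(1) H] .
  have fH: "f i \<in> H" if "i \<in> I" for i
    using f that by (simp add: free_generators_def)
  define act where "act l = (if snd l then f (fst l) else inv_into UNIV (f (fst l)))" for l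
  have actH: "act l \<in> H" if "fst l \<in> I" for l
    using fH[OF that] subgroup_homeo_group(4)[OF H'] by (simp add: act_def)
  have word_act: "word_value (homeo_group\<lparr>carrier := H\<rparr>) f w = foldr act w \<and> foldr act w \<in> H"
    if "fst ` set w \<subseteq> I" for w
    using that
  proof (induction w)
    case Nil
    show ?case
      using subgroup_homeo_group(1)[OF H'] by (simp add: word_value_def homeo_group_def id_def[symmetric])
  next
    case (Cons l w)
    then have l: "fst l \<in> I" and IH: "word_value (homeo_group\<lparr>carrier := H\<rparr>) f w = foldr act w"
      "foldr act w \<in> H" by auto
    have "word_value (homeo_group\<lparr>carrier := H\<rparr>) f (l # w) =
        act l \<circ> word_value (homeo_group\<lparr>carrier := H\<rparr>) f w"
      using subgroup_homeo_group(3)[OF H' fH[OF l]]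
      by (cases l) (simp add: word_value_def act_def homeo_group_def)
    moreover have "foldr act (l # w) = act l \<circ> foldr act w"
      by (simp add: fun_eq_iff)
    ultimately show ?case
      using subgroup_homeo_group(2)[OF H' actH[OF l] IH(2)] IH(1) by metis
  qed
  obtain C where C: "comeager C" "\<And>g x. g \<in> G \<Longrightarrow> x \<in> C \<Longrightarrow> g x \<in> C"
    "\<And>g x. g \<in> G \<Longrightarrow> g \<noteq> id \<Longrightarrow> x \<in> C \<Longrightarrow> g x \<noteq> x"
    "\<And>V x. open V \<Longrightarrow> x \<in> V \<Longrightarrow> x \<in> C \<Longrightarrow>
      \<exists>U. open U \<and> x \<in> U \<and> U \<subseteq> V \<and>
        (\<forall>z\<in>C. \<forall>\<^sub>F y in inf (nhds z) (principal C). y \<in> U \<longleftrightarrow> z \<in> U)"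
    using free_clopen_comeager_set[OF G] by blast
  interpret forest: congruence_forest r J L R by (rule forest)
  interpret congruence_dynamics r J L R I act C
  proof unfold_locales
    fix l :: "nat \<times> bool" and x
    assume l: "fst l \<in> I"
    have hom: "homeomorphism UNIV UNIV (act l) (inv_into UNIV (act l))"
      using subgroup_homeo_group(5)[OF H' actH[OF l]] .
    then show "continuous_on UNIV (act l)" by (simp add: homeomorphism_def)
    show "x \<in> C \<Longrightarrow> act l x \<in> C" using C(2) actH[OF l] HG by blast
    have "bij (f (fst l))"
      using subgroup_homeo_group(5)[OF H' fH[OF l]]
      unfolding homeomorphism_def bij_def by (metis inj_on_inverseI)
    then show "act (inv_letter l) (act l x) = x"
      by (auto simp: act_def inv_letter_def bij_is_surj surj_f_inv_f bij_is_inj)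
  next
    fix w :: "(nat \<times> bool) list" and x
    assume w: "fst ` set w \<subseteq> I" "reduced_word w" "w \<noteq> []" "x \<in> C"
    have "word_value (homeo_group\<lparr>carrier := H\<rparr>) f w \<noteq> \<one>\<^bsub>homeo_group\<lparr>carrier := H\<rparr>\<^esub>"
      using f w by (auto simp: free_generators_def)
    then have "foldr act w \<noteq> id"
      using word_act[OF w(1)] by (simp add: homeo_group_def)
    then show "foldr act w x \<noteq> x"
      using C(3) word_act[OF w(1)] HG w(4) by blast
  qed (use I C in auto)
  obtain A where A: "\<And>k. open (A k)" "\<And>k. k \<in> {1..r} \<Longrightarrow> A k \<noteq> {}"
    "comeager (\<Union>k\<in>{1..r}. A k)" "\<And>x j k. x \<in> C \<Longrightarrow> x \<in> A j \<Longrightarrow> x \<in> A k \<Longrightarrow> j = k"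
    "\<And>x i j k. i \<in> I \<Longrightarrow> i \<in> J \<Longrightarrow> x \<in> C \<Longrightarrow> x \<in> A j \<Longrightarrow> act (i, True) x \<in> A k \<Longrightarrow>
       j \<in> L i \<longleftrightarrow> k \<in> R i"
    using open_quasi_solution by metis
  let ?D = "\<Union>k\<in>{1..r}. A k"
  define E where "E = C \<inter> (\<Inter>g\<in>G. g -` ?D)"
  define \<kappa> where "\<kappa> x = (SOME k. k \<in> {1..r} \<and> x \<in> A k)" for x
  have E_G: "g x \<in> E" if "g \<in> G" "x \<in> E" for g x
  proof -
    have "h (g x) \<in> ?D" if "h \<in> G" for h
    proof -
      have "(h \<circ> g) x \<in> ?D"
        using subgroup_homeo_group(2)[OF G(1) that \<open>g \<in> G\<close>] \<open>x \<in> E\<close> unfolding E_def by blast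
      then show ?thesis by simp
    qed
    then show ?thesis using C(2) that by (auto simp: E_def)
  qed
  have \<kappa>: "\<kappa> x \<in> {1..r} \<and> x \<in> A (\<kappa> x)" if "x \<in> E" for x
  proof -
    have "id x \<in> ?D"
      using that subgroup_homeo_group(1)[OF G(1)] unfolding E_def by blast
    then have "\<exists>k. k \<in> {1..r} \<and> x \<in> A k" by auto
    then show ?thesis unfolding \<kappa>_def by (rule someI_ex)
  qed
  show ?thesis
  proof (rule that[of A E \<kappa>])
    have "meager (- C \<union> (\<Union>g\<in>G. g -` (- ?D)))"
      using C(1) A(3) subgroup_homeo_group(5)[OF G(1)] unfolding comeager_def
      by (intro meager_Un meager_UN G(2) meager_vimage) blast+
    then show "comeager E"
      unfolding comeager_def by (rule meager_subset) (auto simp: E_def)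
    show "tracks E \<kappa> (f i) (L i) (R i)" if i: "i \<in> J" for i
      unfolding tracks_def
    proof
      fix x assume x: "x \<in> E"
      have "f i \<in> G" using fH HG I(3) i by blast
      then have "f i x \<in> A (\<kappa> (f i x))" using \<kappa> E_G x by blast
      then show "\<kappa> x \<in> L i \<longleftrightarrow> \<kappa> (f i x) \<in> R i"
        using A(5)[of i x "\<kappa> x" "\<kappa> (f i x)"] \<kappa>[OF x] x i I(3) by (auto simp: E_def act_def)
    qed
    show "x \<in> A k \<longleftrightarrow> \<kappa> x = k" if "x \<in> E" for x k
      using A(4)[of x "\<kappa> x" k] \<kappa>[OF that] that by (auto simp: E_def)
    show "g ` E \<subseteq> E" if "g \<in> G" for g
      using E_G[OF that] by blast
  qed (use A(1,2) \<kappa> in auto)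
qed

lemma quasi_partition_if_colouring:
  assumes "comeager E" "\<kappa> ` E \<subseteq> {1..r}"
    "\<And>x k. x \<in> E \<Longrightarrow> k \<in> {1..r} \<Longrightarrow> x \<in> A k \<longleftrightarrow> \<kappa> x = k"
  shows "quasi_partition r A"
proof -
  have "meager (- E)" using assms(1) by (simp add: comeager_def)
  moreover have "A j \<inter> A k \<subseteq> - E" if "j \<in> {1..r}" "k \<in> {1..r}" "j \<noteq> k" for j k
    using assms(3) that by blast
  moreover have "- (\<Union>k\<in>{1..r}. A k) \<subseteq> - E"
    using assms(2,3) by blast
  ultimately show ?thesis
    unfolding quasi_partition_def quasi_disjoint_def comeager_def by (meson meager_subset)
qed


section \<open>Solving weak and consistent systems\<close>

theorem theorem2p1:
  fixes G :: "('a::polish_space \<Rightarrow> 'a) set"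
    and r m :: nat
    and L R :: "nat \<Rightarrow> nat set"
  assumes "r \<ge> 1" and "m \<ge> 1"
    and "subgroup G homeo_group" and "countable G"
    and "acts_freely_on_comeager G"
    and "\<exists>H f. subgroup H (homeo_group\<lparr>carrier := G\<rparr>) \<and>
           free_generators (homeo_group\<lparr>carrier := H\<rparr>) {1..m} f"
    and "\<And>i. i \<in> {1..m} \<Longrightarrow> L i \<subseteq> {1..r} \<and> R i \<subseteq> {1..r}"
    and "weak_system r m L R"
    and "consistent_system r m L R"
  shows "(\<exists>A :: nat \<Rightarrow> 'a set.
            (\<forall>k\<in>{1..r}. open (A k) \<and> A k \<noteq> {}) \<and> quasi_solution G r m L R A) \<and>
         (nonredundant_system r m L R \<longrightarrow>
           (\<forall>H f. subgroup H (homeo_group\<lparr>carrier := G\<rparr>) \<and>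
              free_generators (homeo_group\<lparr>carrier := H\<rparr>) {1..m} f \<longrightarrow>
              (\<exists>A :: nat \<Rightarrow> 'a set.
                 (\<forall>k\<in>{1..r}. open (A k) \<and> A k \<noteq> {}) \<and> quasi_solution G r m L R A \<and>
                 (\<forall>i\<in>{1..m}. quasi_congruent_via (f i) (\<Union>k\<in>L i. A k) (\<Union>k\<in>R i. A k)))))"
proof -
  note G = assms(3-5)
  have forest: "congruence_forest r J L R"
    if "J \<subseteq> {1..m}" "\<And>i. i \<in> J \<Longrightarrow> L i \<noteq> R i"
      "\<And>i. i \<in> J \<Longrightarrow> \<not> deducible r (congruences (J - {i}) L R) (L i) (R i)" for J
  proof
    have le: "congruences J L R \<subseteq> congruences {1..m} L R"
      using that(1) by (auto simp: congruences_def)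
    show "\<not> deducible r (congruences J L R) S ({1..r} - S)" if "S \<subseteq> {1..r}" for S
      using assms(8) that deducible_mono[OF _ le] unfolding weak_system_def by metis
    show "\<not> subcongruence r (congruences J L R) S T" if "S \<subseteq> {1..r}" "T \<subset> S" for S T
      using assms(9) that subcongruence_mono[OF _ le] unfolding consistent_system_def by metis
    show "L i \<subseteq> {1..r} \<and> R i \<subseteq> {1..r}" if "i \<in> J" for i
      using assms(7) \<open>J \<subseteq> {1..m}\<close> that by blast
  qed (use assms(1) that in auto)
  have I: "finite {1..m}" "{1..m} \<noteq> {}"
    using assms(2) by auto
  show ?thesis
  proof (intro conjI impI allI)
    obtain H f where H: "subgroup H (homeo_group\<lparr>carrier := G\<rparr>)"
      and f: "free_generators (homeo_group\<lparr>carrier := H\<rparr>) {1..m} f"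
      using assms(6) by blast
    obtain J where J: "J \<subseteq> {1..m}"
        "\<And>i. i \<in> {1..m} \<Longrightarrow> L i = R i \<or> deducible r (congruences J L R) (L i) (R i)"
        "\<And>i. i \<in> J \<Longrightarrow> L i \<noteq> R i"
        "\<And>i. i \<in> J \<Longrightarrow> \<not> deducible r (congruences (J - {i}) L R) (L i) (R i)"
      by (rule nonredundant_core[of "{1..m}" L R r, OF I(1)]) (rule that; assumption)
    have forest_J: "congruence_forest r J L R"
      using J(3,4) by (intro forest[OF J(1)]) blast+
    obtain A E and \<kappa> :: "'a \<Rightarrow> nat" where A: "\<And>k. open (A k)" "\<And>k. k \<in> {1..r} \<Longrightarrow> A k \<noteq> {}"
      and E: "comeager E" "\<And>g. g \<in> G \<Longrightarrow> g ` E \<subseteq> E"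
      and \<kappa>: "\<kappa> ` E \<subseteq> {1..r}" "\<And>x k. x \<in> E \<Longrightarrow> k \<in> {1..r} \<Longrightarrow> x \<in> A k \<longleftrightarrow> \<kappa> x = k"
      and tr: "\<And>i. i \<in> J \<Longrightarrow> tracks E \<kappa> (f i) (L i) (R i)"
      by (rule tracking_colouring[OF G H f I J(1) forest_J])
        (rule that; assumption)
    have fG: "f i \<in> G" if "i \<in> {1..m}" for i
      using f subgroup.subset[OF H] that by (auto simp: free_generators_def)
    have "\<exists>\<sigma>\<in>G. tracks E \<kappa> \<sigma> (L i) (R i)" if i: "i \<in> {1..m}" for i
    proof (cases "L i = R i")
      case True
      then show ?thesis
        using subgroup_homeo_group(1)[OF G(1)] by (intro bexI[of _ id]) (auto simp: tracks_def)
    next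
      case False
      have "\<exists>\<sigma>\<in>G. tracks E \<kappa> \<sigma> S T" if "(S, T) \<in> congruences J L R" for S T
        using that tr fG J(1) unfolding congruences_def by blast
      then show ?thesis
        using tracks_deducible[OF G(1) E(2) \<kappa>(1), of "congruences J L R"] J(2)[OF i] False by blast
    qed
    then have "\<exists>\<sigma>\<in>G. quasi_congruent_via \<sigma> (\<Union>k\<in>L i. A k) (\<Union>k\<in>R i. A k)" if "i \<in> {1..m}" for i
      using tracks_imp_quasi_congruent[OF G(1) _ E \<kappa>(2)] assms(7)[OF that] that by metis
    then show "\<exists>A :: nat \<Rightarrow> 'a set.
        (\<forall>k\<in>{1..r}. open (A k) \<and> A k \<noteq> {}) \<and> quasi_solution G r m L R A"
      using A quasi_partition_if_colouring[OF E(1) \<kappa>] unfolding quasi_solution_def by blast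
  next
    fix H f
    assume nonred: "nonredundant_system r m L R"
      and Hf: "subgroup H (homeo_group\<lparr>carrier := G\<rparr>) \<and>
        free_generators (homeo_group\<lparr>carrier := H\<rparr>) {1..m} f"
    have forest_all: "congruence_forest r {1..m} L R"
      using nonred by (intro forest) (auto simp: nonredundant_system_def)
    obtain A E and \<kappa> :: "'a \<Rightarrow> nat" where A: "\<And>k. open (A k)" "\<And>k. k \<in> {1..r} \<Longrightarrow> A k \<noteq> {}"
      and E: "comeager E" "\<And>g. g \<in> G \<Longrightarrow> g ` E \<subseteq> E"
      and \<kappa>: "\<kappa> ` E \<subseteq> {1..r}" "\<And>x k. x \<in> E \<Longrightarrow> k \<in> {1..r} \<Longrightarrow> x \<in> A k \<longleftrightarrow> \<kappa> x = k"
      and tr: "\<And>i. i \<in> {1..m} \<Longrightarrow> tracks E \<kappa> (f i) (L i) (R i)"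
      by (rule tracking_colouring[OF G conjunct1[OF Hf] conjunct2[OF Hf] I order_refl forest_all])
        (rule that; assumption)
    have fG: "f i \<in> G" if "i \<in> {1..m}" for i
      using Hf subgroup.subset[OF conjunct1[OF Hf]] that by (auto simp: free_generators_def)
    have "quasi_congruent_via (f i) (\<Union>k\<in>L i. A k) (\<Union>k\<in>R i. A k)" if "i \<in> {1..m}" for i
      using tracks_imp_quasi_congruent[OF G(1) fG[OF that] E \<kappa>(2) tr[OF that]] assms(7)[OF that]
      by blast
    then show "\<exists>A :: nat \<Rightarrow> 'a set.
        (\<forall>k\<in>{1..r}. open (A k) \<and> A k \<noteq> {}) \<and> quasi_solution G r m L R A \<and>
        (\<forall>i\<in>{1..m}. quasi_congruent_via (f i) (\<Union>k\<in>L i. A k) (\<Union>k\<in>R i. A k))"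
      using A fG quasi_partition_if_colouring[OF E(1) \<kappa>] unfolding quasi_solution_def by blast
  qed
qed

end
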